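(* Let $n\ge 1$. Every matrix $A\in M_n(\mathbb{C})$ with zero trace may be written as $A=[B,C]$ with $B,C\in M_n(\mathbb{C})$ such that $$\|B\|\,\|C\|\le 300\,e^{9\sqrt{\log n}}\,\|A\|.$$
   Context: $[B,C]=BC-CB$, $\|\cdot\|$ is the operator norm, and $\log$ is the natural logarithm. *)

theory Defs
  imports "HOL-Analysis.Analysis"
begin

definition commutator :: "'a::ring_1^'n^'n \<Rightarrow> 'a^'n^'n \<Rightarrow> 'a^'n^'n" where
  "commutator B C = B ** C - C ** B"

text \<open>The norm on \<^typ>\<open>complex^'n\<close> is the Euclidean one, so this is the operator norm
  induced by the Hilbert space norm on both sides (not \<^term>\<open>norm A\<close>, which is the Frobenius norm).\<close>

definition op_norm :: "complex^'n^'n \<Rightarrow> real" where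
  "op_norm A = onorm (\<lambda>x. A *v x)"

end

theory Submission
  imports Defs "HOL-Library.Disjoint_Sets"
begin

text \<open>
Since the orthonormal basis in which \<open>B\<close> is diagonal may be chosen freely, the theorem needs no deep paving
result; an elementary one for freely chosen subspaces suffices.

Suppose that \<open>A\<close> has zero diagonal in an orthonormal basis, and let \<open>B\<close> be diagonal there with distinct
eigenvalues \<open>b\<^sub>i\<close> in the unit disc. Then \<open>A = [B, C]\<close> for the matrix \<open>C\<close> with entries \<open>a\<^sub>i\<^sub>j / (b\<^sub>i - b\<^sub>j)\<close>, and
the task is to choose basis and eigenvalues such that \<open>C\<close> is not much larger than \<open>A\<close>. If the space is
an orthogonal sum of \<open>r\<close> subspaces, the eigenvalues of \<open>B\<close> on these can be put into \<open>r\<close> separated discs of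
radius of order \<open>r\<^sup>-\<^sup>1\<^sup>/\<^sup>2\<close>. Separation bounds the off-diagonal blocks of \<open>C\<close> by a power of \<open>r\<close> times the
norm of \<open>A\<close> (lemmas \<open>matrix_bounded_separated\<close> and \<open>matrix_bounded_blocks\<close>). The diagonal blocks are handled
by recursion; scaling the discs costs a factor of order \<open>r\<^sup>1\<^sup>/\<^sup>2\<close>, so this works well if the compressions of
\<open>A\<close> to the subspaces have trace zero and norm of order \<open>r\<^sup>-\<^sup>1\<^sup>/\<^sup>2\<close> times that of \<open>A\<close>.

Such subspaces are provided by lemma \<open>paving\<close>. For a Hermitian \<open>H\<close> of trace zero, order the eigenvalues with
bounded partial sums, pair consecutive eigenvectors, and pass from each pair \<open>v, v'\<close> to \<open>(v \<plusminus> u v') / \<surd>2\<close>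
with \<open>\<bar>u\<bar> = 1\<close>. The two resulting subspaces carry diagonal compressions of \<open>H\<close> with averaged eigenvalues; after \<open>p\<close>
rounds there are \<open>2\<^sup>p\<close> subspaces, and \<open>H\<close> has norm at most \<open>2 / 2\<^sup>p\<close> times the original one on each (lemma \<open>halving\<close>). The
phase \<open>u\<close> is still free, and it can be used to keep the trace of a second Hermitian form exactly zero.
Applying this to the real part of \<open>A\<close> and then, inside each subspace, to the imaginary part yields
\<open>r = 4\<^sup>p\<close> subspaces on which \<open>A\<close> has norm at most \<open>4 / 2\<^sup>p = 4 r\<^sup>-\<^sup>1\<^sup>/\<^sup>2\<close> times the original one. Divisibility of the dimension is
arranged by first splitting off fewer than \<open>4\<^sup>p\<close> unit vectors \<open>x\<close> with \<open>\<langle>A x, x\<rangle> = 0\<close>, found by the same phase trick.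

Each level of the recursion divides the dimension by \<open>4\<^sup>p\<close> and multiplies the constant by \<open>40\<close>, starting
from a constant of order \<open>8\<^sup>p\<close>; with \<open>p\<close> of order \<open>\<surd>(ln n)\<close> this is \<open>exp (O (\<surd>(ln n)))\<close>.
\<close>

section \<open>Sesquilinear forms and orthonormal families\<close>

text \<open>The argument works with the form \<open>\<langle>A x, y\<rangle>\<close> rather than the matrix \<open>A\<close>, because compressions of \<open>A\<close> to
subspaces, which drive the argument, are then just restrictions of one fixed form. Subspaces are
presented by orthonormal sets spanning them.\<close>

locale sesquilinear =
  fixes \<alpha> :: "complex^'n \<Rightarrow> complex^'n \<Rightarrow> complex"
  assumes add_left: "\<alpha> (x + y) z = \<alpha> x z + \<alpha> y z"
    and add_right: "\<alpha> x (y + z) = \<alpha> x y + \<alpha> x z"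
    and scale_left: "\<alpha> (c *s x) y = c * \<alpha> x y"
    and scale_right: "\<alpha> x (c *s y) = cnj c * \<alpha> x y"
begin

lemma zero_left [simp]: "\<alpha> 0 y = 0"
  using scale_left[of 0 0 y] by simp

lemma zero_right [simp]: "\<alpha> x 0 = 0"
  using scale_right[of x 0 0] by simp

lemma diff_left: "\<alpha> (x - y) z = \<alpha> x z - \<alpha> y z"
  using add_left[of "x - y" y z] by simp

lemma diff_right: "\<alpha> x (y - z) = \<alpha> x y - \<alpha> x z"
  using add_right[of x "y - z" z] by simp

lemma sum_left: "\<alpha> (\<Sum>i\<in>I. f i) y = (\<Sum>i\<in>I. \<alpha> (f i) y)"
  by (induction I rule: infinite_finite_induct) (auto simp: add_left)

lemma sum_right: "\<alpha> x (\<Sum>i\<in>I. f i) = (\<Sum>i\<in>I. \<alpha> x (f i))"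
  by (induction I rule: infinite_finite_induct) (auto simp: add_right)

lemma sum_sum:
  "\<alpha> (\<Sum>v\<in>S. c v *s f v) (\<Sum>w\<in>T. d w *s g w) = (\<Sum>v\<in>S. \<Sum>w\<in>T. c v * cnj (d w) * \<alpha> (f v) (g w))"
  unfolding sum_left scale_left unfolding sum_right scale_right by (simp add: sum_distrib_left mult_ac)

lemmas expand = add_left add_right diff_left diff_right scale_left scale_right

end

locale hermitian_form = sesquilinear +
  assumes hermitian: "\<alpha> y x = cnj (\<alpha> x y)"
begin

lemma diagonal_real: "\<alpha> x x = of_real (Re (\<alpha> x x))"
  using hermitian[of x x] by (metis Reals_cnj_iff of_real_Re)

end

definition cdot :: "complex^'n \<Rightarrow> complex^'n \<Rightarrow> complex" where
  "cdot x y = (\<Sum>i\<in>UNIV. x $ i * cnj (y $ i))"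

interpretation cdot: hermitian_form cdot
  by unfold_locales
     (auto simp: cdot_def algebra_simps sum.distrib sum_distrib_left)

lemma cdot_self: "cdot x x = of_real ((norm x)\<^sup>2)"
  by (simp add: cdot_def norm_vec_def L2_set_def sum_nonneg complex_norm_square del: of_real_power)

lemma Re_cdot: "Re (cdot x y) = x \<bullet> y"
  by (simp add: cdot_def inner_vec_def inner_complex_def)

lemma norm_scale: "norm (c *s x) = cmod c * norm (x :: complex^'n)"
proof -
  have "norm (c *s x) = L2_set (\<lambda>i. cmod c * cmod (x $ i)) UNIV"
    by (simp add: norm_vec_def norm_mult)
  then show ?thesis
    by (simp add: norm_vec_def L2_set_right_distrib[symmetric])
qed

lemma cdot_Cauchy_Schwarz: "cmod (cdot x y) \<le> norm x * norm y"
proof -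
  obtain u where u: "cmod u = 1" "u * cdot x y = of_real (cmod (cdot x y))"
  proof (cases "cdot x y = 0")
    case True
    then show ?thesis using that[of 1] by simp
  next
    case False
    show ?thesis
      by (rule that[of "of_real (cmod (cdot x y)) / cdot x y"])
         (use False in \<open>auto simp: norm_divide\<close>)
  qed
  have "cmod (cdot x y) = Re (cdot (u *s x) y)"
    using u by (simp add: cdot.scale_left)
  also have "\<dots> \<le> norm (u *s x) * norm y"
    unfolding Re_cdot by (rule norm_cauchy_schwarz)
  finally show ?thesis using u by (simp add: norm_scale)
qed

definition orthonormal :: "(complex^'n) set \<Rightarrow> bool" where
  "orthonormal S \<longleftrightarrow> finite S \<and> (\<forall>v\<in>S. \<forall>w\<in>S. cdot v w = of_bool (v = w))"

lemma orthonormalD: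
  assumes "orthonormal S"
  shows "finite S" "\<And>v w. v \<in> S \<Longrightarrow> w \<in> S \<Longrightarrow> cdot v w = of_bool (v = w)"
  using assms by (auto simp: orthonormal_def)

lemma orthonormal_subset: "orthonormal S \<Longrightarrow> T \<subseteq> S \<Longrightarrow> orthonormal T"
  unfolding orthonormal_def by (meson finite_subset subsetD)

lemma cdot_sum_orthonormal:
  assumes "orthonormal S" "w \<in> S"
  shows "cdot (\<Sum>v\<in>S. c v *s v) w = c w"
proof -
  have "cdot (\<Sum>v\<in>S. c v *s v) w = (\<Sum>v\<in>S. if v = w then c v else 0)"
    using assms by (auto simp: cdot.sum_left cdot.scale_left orthonormal_def intro!: sum.cong)
  then show ?thesis using assms by (simp add: orthonormal_def)
qed

lemma orthonormal_expansion:
  assumes "orthonormal S" "x \<in> vec.span S"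
  shows "x = (\<Sum>v\<in>S. cdot x v *s v)"
proof -
  obtain c where c: "x = (\<Sum>v\<in>S. c v *s v)"
    using assms by (auto simp: vec.span_finite orthonormal_def)
  then have "\<And>v. v \<in> S \<Longrightarrow> cdot x v = c v"
    using cdot_sum_orthonormal[OF assms(1)] by simp
  then show ?thesis by (subst c, intro sum.cong) auto
qed

lemma norm_sum_orthonormal:
  assumes "orthonormal S"
  shows "norm (\<Sum>v\<in>S. c v *s v) = L2_set (\<lambda>v. cmod (c v)) S"
proof -
  let ?x = "\<Sum>v\<in>S. c v *s v"
  have "cdot ?x ?x = (\<Sum>v\<in>S. cnj (c v) * cdot ?x v)"
    by (simp add: cdot.sum_right cdot.scale_right)
  also have "\<dots> = (\<Sum>v\<in>S. of_real ((cmod (c v))\<^sup>2))"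
    by (intro sum.cong refl) (simp only: cdot_sum_orthonormal[OF assms] complex_norm_square mult.commute)
  finally have "complex_of_real ((norm ?x)\<^sup>2) = of_real (\<Sum>v\<in>S. (cmod (c v))\<^sup>2)"
    unfolding cdot_self by simp
  then have "(norm ?x)\<^sup>2 = (\<Sum>v\<in>S. (cmod (c v))\<^sup>2)"
    by (simp only: of_real_eq_iff)
  then show ?thesis by (simp add: L2_set_def real_sqrt_unique)
qed

lemma norm_eq_L2_coordinates:
  assumes "orthonormal S" "x \<in> vec.span S"
  shows "norm x = L2_set (\<lambda>v. cmod (cdot x v)) S"
  using norm_sum_orthonormal[OF assms(1), of "cdot x"] orthonormal_expansion[OF assms] by simp

lemma norm_orthonormal:
  assumes "orthonormal S" "v \<in> S"
  shows "norm v = 1"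
proof -
  have "complex_of_real ((norm v)\<^sup>2) = of_real 1"
    using assms orthonormalD[OF assms(1)] cdot_self[of v] by simp
  then have "(norm v)\<^sup>2 = 1" by (simp only: of_real_eq_iff)
  then show ?thesis by (simp add: power2_eq_1_iff) (use norm_ge_zero[of v] in linarith)
qed

lemma orthonormal_independent:
  assumes "orthonormal S"
  shows "vec.independent S"
proof -
  have "c w = 0" if "(\<Sum>v\<in>S. c v *s v) = 0" "w \<in> S" for c w
    using cdot_sum_orthonormal[OF assms that(2), of c] that by simp
  then show ?thesis
    using assms by (auto simp: vec.dependent_finite orthonormal_def)
qed

lemma orthonormal_card: "orthonormal S \<Longrightarrow> card S = vec.dim (vec.span S)"
  by (simp add: orthonormal_independent vec.dim_eq_card_independent)

lemma orthonormal_span_eqI: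
  assumes "orthonormal T" "T \<subseteq> vec.span S" "finite S" "card S \<le> card T"
  shows "vec.span T = vec.span S"
proof
  show "vec.span T \<subseteq> vec.span S"
    using assms(2) by (simp add: vec.span_minimal)
  have "vec.dim (vec.span S) \<le> card T"
    using assms(3,4) vec.dim_le_card[of "vec.span S" S] by simp
  then show "vec.span S \<subseteq> vec.span T"
    by (rule vec.card_ge_dim_independent[OF assms(2) orthonormal_independent[OF assms(1)]])
qed

lemma span_orthogonal:
  assumes "x \<in> vec.span S" "\<And>v. v \<in> S \<Longrightarrow> cdot v y = 0"
  shows "cdot x y = 0"
  using assms(1) by (induction rule: vec.span_induct_alt) (auto simp: cdot.expand assms(2))

lemma span_orthogonal_span:
  assumes "x \<in> vec.span S" "y \<in> vec.span T" "\<And>v w. v \<in> S \<Longrightarrow> w \<in> T \<Longrightarrow> cdot v w = 0"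
  shows "cdot x y = 0"
proof -
  have "cdot y x = 0"
  proof (rule span_orthogonal[OF assms(2)])
    fix w assume "w \<in> T"
    then have "cdot x w = 0" using span_orthogonal[OF assms(1)] assms(3) by blast
    then show "cdot w x = 0" by (subst cdot.hermitian) simp
  qed
  then show ?thesis by (subst cdot.hermitian) simp
qed

text \<open>For an orthonormal set \<open>S\<close> this is the trace of the compression of the form to the span of \<open>S\<close>; the
next lemma is the usual basis independence, needed since the bases are changed all the time.\<close>

definition trace_on :: "(complex^'n \<Rightarrow> complex^'n \<Rightarrow> complex) \<Rightarrow> (complex^'n) set \<Rightarrow> complex" where
  "trace_on \<alpha> S = (\<Sum>v\<in>S. \<alpha> v v)"

lemma (in sesquilinear) trace_on_cong_span:
  assumes S: "orthonormal S" and T: "orthonormal T" and "vec.span S = vec.span T"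
  shows "trace_on \<alpha> S = trace_on \<alpha> T"
proof -
  have delta: "(\<Sum>w\<in>T. cdot w v * cdot u w) = of_bool (u = v)" if "u \<in> S" "v \<in> S" for u v
  proof -
    have "u \<in> vec.span T" using that assms(3) vec.span_base by blast
    then have "u = (\<Sum>w\<in>T. cdot u w *s w)" by (rule orthonormal_expansion[OF T])
    then have "cdot u v = (\<Sum>w\<in>T. cdot u w * cdot w v)"
      by (subst (asm) \<open>u = _\<close>) (metis (no_types, lifting) \<open>u = _\<close> cdot.scale_left cdot.sum_left sum.cong)
    then show ?thesis using orthonormalD(2)[OF S that] by (simp add: mult.commute)
  qed
  have "trace_on \<alpha> T = (\<Sum>w\<in>T. \<Sum>u\<in>S. \<Sum>v\<in>S. cdot w u * cnj (cdot w v) * \<alpha> u v)"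
    unfolding trace_on_def
  proof (rule sum.cong[OF refl])
    fix w assume "w \<in> T"
    then have "w \<in> vec.span S" using assms(3) vec.span_base by blast
    note e = orthonormal_expansion[OF S this]
    have "\<alpha> w w = \<alpha> (\<Sum>u\<in>S. cdot w u *s u) (\<Sum>v\<in>S. cdot w v *s v)"
      using e by simp
    also have "\<dots> = (\<Sum>u\<in>S. \<Sum>v\<in>S. cdot w u * cnj (cdot w v) * \<alpha> u v)"
      by (rule sum_sum)
    finally show "\<alpha> w w = (\<Sum>u\<in>S. \<Sum>v\<in>S. cdot w u * cnj (cdot w v) * \<alpha> u v)" .
  qed
  also have "\<dots> = (\<Sum>u\<in>S. \<Sum>w\<in>T. \<Sum>v\<in>S. cdot w u * cnj (cdot w v) * \<alpha> u v)"
    by (rule sum.swap)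
  also have "\<dots> = (\<Sum>u\<in>S. \<Sum>v\<in>S. (\<Sum>w\<in>T. cdot w u * cdot v w) * \<alpha> u v)"
  proof (rule sum.cong[OF refl])
    fix u assume "u \<in> S"
    have "(\<Sum>w\<in>T. \<Sum>v\<in>S. cdot w u * cnj (cdot w v) * \<alpha> u v)
        = (\<Sum>v\<in>S. \<Sum>w\<in>T. cdot w u * cnj (cdot w v) * \<alpha> u v)" by (rule sum.swap)
    then show "(\<Sum>w\<in>T. \<Sum>v\<in>S. cdot w u * cnj (cdot w v) * \<alpha> u v)
        = (\<Sum>v\<in>S. (\<Sum>w\<in>T. cdot w u * cdot v w) * \<alpha> u v)"
      by (simp add: sum_distrib_right flip: cdot.hermitian)
  qed
  also have "\<dots> = (\<Sum>u\<in>S. \<Sum>v\<in>S. if u = v then \<alpha> u v else 0)"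
    by (intro sum.cong refl) (auto simp: delta)
  also have "\<dots> = trace_on \<alpha> S"
    using orthonormalD(1)[OF S] by (simp add: trace_on_def)
  finally show ?thesis by simp
qed

definition bounded_on :: "(complex^'n \<Rightarrow> complex^'n \<Rightarrow> complex) \<Rightarrow> (complex^'n) set \<Rightarrow> real \<Rightarrow> bool" where
  "bounded_on \<alpha> E c \<longleftrightarrow> (\<forall>x\<in>E. \<forall>y\<in>E. cmod (\<alpha> x y) \<le> c * norm x * norm y)"

lemma bounded_on_subset: "bounded_on \<alpha> E c \<Longrightarrow> F \<subseteq> E \<Longrightarrow> bounded_on \<alpha> F c"
  by (auto simp: bounded_on_def)

lemma (in sesquilinear) bounded_on_diagonal:
  assumes S: "orthonormal S" and off: "\<And>v w. v \<in> S \<Longrightarrow> w \<in> S \<Longrightarrow> v \<noteq> w \<Longrightarrow> \<alpha> v w = 0"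
    and c: "\<And>v. v \<in> S \<Longrightarrow> cmod (\<alpha> v v) \<le> c" and "c \<ge> 0"
  shows "bounded_on \<alpha> (vec.span S) c"
  unfolding bounded_on_def
proof (intro ballI)
  fix x y assume x: "x \<in> vec.span S" and y: "y \<in> vec.span S"
  have fin: "finite S" using S by (rule orthonormalD)
  have "\<alpha> x y = \<alpha> (\<Sum>v\<in>S. cdot x v *s v) (\<Sum>v\<in>S. cdot y v *s v)"
    using orthonormal_expansion[OF S x] orthonormal_expansion[OF S y] by simp
  also have "\<dots> = (\<Sum>v\<in>S. \<Sum>w\<in>S. cdot x v * cnj (cdot y w) * \<alpha> v w)"
    by (rule sum_sum)
  also have "\<dots> = (\<Sum>v\<in>S. \<Sum>w\<in>S. if v = w then cdot x v * cnj (cdot y w) * \<alpha> v w else 0)"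
    by (intro sum.cong refl) (auto simp: off)
  also have "\<dots> = (\<Sum>v\<in>S. cdot x v * cnj (cdot y v) * \<alpha> v v)"
    using fin by simp
  finally have "cmod (\<alpha> x y) \<le> (\<Sum>v\<in>S. cmod (cdot x v) * cmod (cdot y v) * cmod (\<alpha> v v))"
    by (metis (no_types, lifting) complex_mod_cnj norm_mult norm_sum sum.cong)
  also have "\<dots> \<le> (\<Sum>v\<in>S. cmod (cdot x v) * cmod (cdot y v) * c)"
    by (intro sum_mono mult_left_mono c) auto
  also have "\<dots> = c * (\<Sum>v\<in>S. \<bar>cmod (cdot x v)\<bar> * \<bar>cmod (cdot y v)\<bar>)"
    by (simp add: sum_distrib_left mult_ac)
  also have "\<dots> \<le> c * (norm x * norm y)"
    unfolding norm_eq_L2_coordinates[OF S x] norm_eq_L2_coordinates[OF S y]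
    by (intro mult_left_mono L2_set_mult_ineq \<open>c \<ge> 0\<close>)
  finally show "cmod (\<alpha> x y) \<le> c * norm x * norm y" by (simp add: mult.assoc)
qed

section \<open>Diagonalization of Hermitian forms\<close>

lemma scaleR_eq_scale: "c *\<^sub>R x = complex_of_real c *s (x :: complex^'n)"
  by (simp add: vec_eq_iff) (simp add: scaleR_conv_of_real)

lemma vec_subspace_imp_subspace:
  fixes E :: "(complex^'n) set"
  assumes "vec.subspace E"
  shows "subspace E"
  using assms by (auto simp: subspace_def vec.subspace_def scaleR_eq_scale)

lemma (in sesquilinear) bounded_bilinear: "bounded_bilinear \<alpha>"
proof -
  have "bilinear \<alpha>"
    unfolding bilinear_def by (auto intro!: linearI simp: scaleR_eq_scale expand scaleR_conv_of_real)
  then show ?thesis by (simp add: bilinear_conv_bounded_bilinear)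
qed

text \<open>The first-order condition behind the variational proof of the spectral theorem.\<close>

lemma nonneg_quadratic_imp_linear_zero:
  fixes p q :: real
  assumes "\<And>t. t * p + t\<^sup>2 * q \<ge> 0"
  shows "p = 0"
proof (rule ccontr)
  assume "p \<noteq> 0"
  \<comment> \<open>For small \<open>t\<close> of the sign opposite to \<open>p\<close> the linear term dominates.\<close>
  define Q where "Q = \<bar>q\<bar> + 1"
  have Q: "Q > 0" "q < Q" by (auto simp: Q_def)
  have "(- p / Q) * p + (- p / Q)\<^sup>2 * q = p\<^sup>2 * (q - Q) / Q\<^sup>2"
    using Q by (simp add: field_simps power2_eq_square)
  also have "\<dots> < 0"
    using Q \<open>p \<noteq> 0\<close> by (intro divide_neg_pos mult_pos_neg) auto
  finally show False using assms[of "- p / Q"] by simp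
qed

lemma orthonormal_insert_complement:
  assumes E: "vec.subspace E" and x: "x \<in> E" "norm x = 1"
    and S: "orthonormal S" "vec.span S = {y \<in> E. cdot y x = 0}"
  shows "x \<notin> S" "orthonormal (insert x S)" "vec.span (insert x S) = E"
proof -
  have xx: "cdot x x = 1" using x by (simp add: cdot_self)
  have SE: "v \<in> E" "cdot v x = 0" "cdot x v = 0" if "v \<in> S" for v
    using S(2) vec.span_base[OF that] cdot.hermitian[of v x] by auto
  show "x \<notin> S" using SE xx by force
  show "orthonormal (insert x S)" using S(1) SE xx by (auto simp: orthonormal_def)
  show "vec.span (insert x S) = E"
  proof
    show "vec.span (insert x S) \<subseteq> E" using SE x E by (intro vec.span_minimal) auto
    show "E \<subseteq> vec.span (insert x S)"
    proof
      fix y assume "y \<in> E"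
      then have "y - cdot y x *s x \<in> vec.span S"
        using x xx E by (simp add: S(2) cdot.expand vec.subspace_diff vec.subspace_scale)
      then show "y \<in> vec.span (insert x S)" by (auto simp: vec.span_insert)
    qed
  qed
qed

context hermitian_form
begin

lemma Re_swap: "Re (\<alpha> y x) = Re (\<alpha> x y)"
  by (subst hermitian) simp

text \<open>A unit vector \<open>x\<close> that maximizes the Rayleigh quotient on \<open>E\<close> is an eigenvector of the compression: moving
from \<open>x\<close> in the direction \<open>w \<bottom> x\<close> cannot increase the quotient, so the linear term \<open>Re (\<alpha> x w)\<close> vanishes, and
replacing \<open>w\<close> by \<open>\<i> w\<close> removes the imaginary part too.\<close>

lemma maximizer_orthogonal:
  assumes E: "vec.subspace E" and x: "x \<in> E" "norm x = 1"
    and max: "\<And>z. z \<in> E \<Longrightarrow> Re (\<alpha> z z) \<le> Re (\<alpha> x x) * (norm z)\<^sup>2"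
    and y: "y \<in> E" "cdot y x = 0"
  shows "\<alpha> x y = 0"
proof -
  have re0: "Re (\<alpha> x w) = 0" if w: "w \<in> E" "cdot w x = 0" for w
  proof -
    let ?M = "Re (\<alpha> x x)"
    have "t * (- 2 * Re (\<alpha> x w)) + t\<^sup>2 * (?M * (norm w)\<^sup>2 - Re (\<alpha> w w)) \<ge> 0" for t
    proof -
      let ?z = "x + of_real t *s w"
      have "x \<bullet> w = 0" using w by (metis Re_cdot cdot.Re_swap zero_complex.simps(1))
      then have "(norm ?z)\<^sup>2 = 1 + t\<^sup>2 * (norm w)\<^sup>2"
        using x(2) unfolding scaleR_eq_scale[symmetric] power2_norm_eq_inner
        by (simp add: inner_add inner_commute norm_eq_1 power2_eq_square mult.assoc)
      moreover have "Re (\<alpha> ?z ?z) = ?M + 2 * t * Re (\<alpha> x w) + t\<^sup>2 * Re (\<alpha> w w)"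
        using Re_swap[of x w] by (simp add: expand algebra_simps power2_eq_square)
      moreover have "?z \<in> E" using E x w by (simp add: vec.subspace_add vec.subspace_scale)
      ultimately show ?thesis using max[of ?z] by (simp add: algebra_simps)
    qed
    from nonneg_quadratic_imp_linear_zero[OF this] show ?thesis by simp
  qed
  have "Re (\<alpha> x y) = 0" using re0 y by simp
  moreover have "Re (\<alpha> x (\<i> *s y)) = 0"
    using re0 y E by (simp add: vec.subspace_scale cdot.scale_left)
  ultimately show ?thesis by (simp add: scale_right complex_eq_iff)
qed

lemma diagonalization:
  assumes "vec.subspace E"
  shows "\<exists>S. orthonormal S \<and> vec.span S = E \<and> (\<forall>v\<in>S. \<forall>w\<in>S. v \<noteq> w \<longrightarrow> \<alpha> v w = 0)"
  using assms
proof (induction "vec.dim E" arbitrary: E rule: less_induct)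
  case less
  show ?case
  proof (cases "E = {0}")
    case True
    then show ?thesis by (intro exI[of _ "{}"]) (auto simp: orthonormal_def)
  next
    case False
    then obtain e where e: "e \<in> E" "e \<noteq> 0"
      using less.prems vec.subspace_0 by blast
    \<comment> \<open>The Rayleigh quotient attains its maximum on the unit sphere of \<open>E\<close>.\<close>
    let ?K = "E \<inter> sphere 0 1"
    have "compact ?K"
      using vec_subspace_imp_subspace[OF less.prems]
      by (intro closed_Int_compact closed_subspace) auto
    moreover have "of_real (1 / norm e) *s e \<in> ?K"
      using e less.prems by (simp add: vec.subspace_scale norm_scale norm_divide)
    moreover have "continuous_on ?K (\<lambda>z. Re (\<alpha> z z))"
      by (intro continuous_intros bounded_bilinear.continuous_on[OF bounded_bilinear])
    ultimately obtain x where x: "x \<in> ?K" and xmax: "\<forall>z\<in>?K. Re (\<alpha> z z) \<le> Re (\<alpha> x x)"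
      using continuous_attains_sup[of ?K] by blast
    have x1: "x \<in> E" "norm x = 1" using x by auto
    then have xx: "cdot x x = 1" by (simp add: cdot_self)
    have max: "Re (\<alpha> z z) \<le> Re (\<alpha> x x) * (norm z)\<^sup>2" if "z \<in> E" for z
    proof (cases "z = 0")
      case False
      let ?u = "of_real (1 / norm z) *s z"
      have "?u \<in> ?K" using that False less.prems by (simp add: vec.subspace_scale norm_scale norm_divide)
      then have "Re (\<alpha> ?u ?u) \<le> Re (\<alpha> x x)" using xmax by blast
      moreover have "Re (\<alpha> ?u ?u) = Re (\<alpha> z z) / (norm z)\<^sup>2"
        by (simp add: expand power2_eq_square flip: of_real_divide of_real_mult)
      ultimately show ?thesis using False by (simp add: divide_le_eq)
    qed simp
    define F where "F = {y \<in> E. cdot y x = 0}"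
    have F: "vec.subspace F"
      using less.prems by (auto simp: F_def vec.subspace_def cdot.expand)
    have "x \<notin> F" using xx by (simp add: F_def)
    then have "F \<subset> E" using x1 by (auto simp: F_def)
    then have "vec.dim F < vec.dim E"
      using vec.dim_psubset[of F E] F less.prems by (metis vec.span_eq_iff)
    from less.hyps[OF this F] obtain S where S: "orthonormal S" "vec.span S = F"
      "\<forall>v\<in>S. \<forall>w\<in>S. v \<noteq> w \<longrightarrow> \<alpha> v w = 0" by blast
    note ins = orthonormal_insert_complement[OF less.prems x1 S(1) S(2)[unfolded F_def]]
    have SF: "v \<in> E" "cdot v x = 0" if "v \<in> S" for v
      using S(2) vec.span_base[OF that] by (auto simp: F_def)
    have "\<alpha> x v = 0" "\<alpha> v x = 0" if "v \<in> S" for v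
      using maximizer_orthogonal[OF less.prems x1 max SF[OF that]] hermitian[of v x] by auto
    then show ?thesis
      using S(3) ins(2,3) by (intro exI[of _ "insert x S"]) auto
  qed
qed

end

lemma orthonormal_basis_exists:
  assumes "vec.subspace E"
  shows "\<exists>S. orthonormal S \<and> vec.span S = E"
  using cdot.diagonalization[OF assms] by blast

lemma orthonormal_extend:
  assumes x: "x \<in> vec.span S" "norm x = 1"
  shows "\<exists>T. x \<notin> T \<and> orthonormal (insert x T) \<and> vec.span (insert x T) = vec.span S"
proof -
  have "vec.subspace {y \<in> vec.span S. cdot y x = 0}"
    by (auto simp: vec.subspace_def cdot.expand vec.span_zero vec.span_add vec.span_scale)
  then obtain T where "orthonormal T" "vec.span T = {y \<in> vec.span S. cdot y x = 0}"
    using orthonormal_basis_exists by blast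
  then show ?thesis
    using orthonormal_insert_complement[OF vec.subspace_span x] by blast
qed

section \<open>Isotropic vectors\<close>

text \<open>The one degree of freedom that all trace balancing uses: a phase can make any complex number purely
imaginary.\<close>

lemma phase_exists: "\<exists>c. cmod c = 1 \<and> Re (c * z) = 0"
proof (cases "z = 0")
  case False
  let ?c = "\<i> * cnj z / of_real (cmod z)"
  have "?c * z = \<i> * of_real (cmod z)"
    using False by (simp add: field_simps complex_norm_square[symmetric] power2_eq_square)
  then have "Re (?c * z) = 0" by simp
  moreover have "cmod ?c = 1" using False by (simp add: norm_mult norm_divide)
  ultimately show ?thesis by blast
qed (auto intro: exI[of _ 1])

text \<open>The vectors enter one at a time, each with a phase that makes its cross term with the earlier ones
purely imaginary; the real part is all that a Hermitian form sees of it.\<close>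

lemma (in hermitian_form) sum_of_phases:
  assumes "finite S"
  shows "\<exists>u. (\<forall>v. cmod (u v) = 1) \<and>
    \<alpha> (\<Sum>v\<in>S. u v *s v) (\<Sum>v\<in>S. u v *s v) = trace_on \<alpha> S"
  using assms
proof (induction S rule: finite_induct)
  case empty
  then show ?case by (auto simp: trace_on_def intro: exI[of _ "\<lambda>_. 1"])
next
  case (insert w S)
  then obtain u where u: "\<forall>v. cmod (u v) = 1"
    "\<alpha> (\<Sum>v\<in>S. u v *s v) (\<Sum>v\<in>S. u v *s v) = trace_on \<alpha> S" by blast
  let ?x = "\<Sum>v\<in>S. u v *s v"
  obtain c where c: "cmod c = 1" "Re (c * \<alpha> w ?x) = 0" using phase_exists by blast
  have cc: "c * cnj c = 1" using c(1) complex_norm_square[of c] by simp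
  have "(\<Sum>v\<in>insert w S. (u(w := c)) v *s v) = c *s w + ?x"
    using insert.hyps by (auto intro!: sum.cong)
  moreover have "\<alpha> (c *s w + ?x) (c *s w + ?x)
      = (c * cnj c) * \<alpha> w w + \<alpha> ?x ?x + (c * \<alpha> w ?x + cnj (c * \<alpha> w ?x))"
    using hermitian[of ?x w] by (simp add: expand algebra_simps)
  moreover have "c * \<alpha> w ?x + cnj (c * \<alpha> w ?x) = 0"
    using c(2) by (simp only: complex_add_cnj) simp
  ultimately have "\<alpha> (\<Sum>v\<in>insert w S. (u(w := c)) v *s v) (\<Sum>v\<in>insert w S. (u(w := c)) v *s v)
      = trace_on \<alpha> (insert w S)"
    using cc u(2) insert.hyps by (simp add: trace_on_def)
  then show ?case using u(1) c(1) by (intro exI[of _ "u(w := c)"]) auto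
qed

text \<open>Two Hermitian forms of trace zero have a common isotropic unit vector, that is, a matrix of trace zero
has \<open>0\<close> in its numerical range. In a basis diagonalizing \<open>\<eta>\<close>, every vector whose coordinates all have
the same modulus has \<open>\<eta> x x\<close> proportional to the trace of \<open>\<eta>\<close>, and the phases are left to deal with \<open>\<kappa>\<close>.\<close>

lemma joint_isotropic_vector:
  assumes "hermitian_form \<eta>" "hermitian_form \<kappa>" and S: "orthonormal S" "S \<noteq> {}"
    and tr: "trace_on \<eta> S = 0" "trace_on \<kappa> S = 0"
  shows "\<exists>x \<in> vec.span S. norm x = 1 \<and> \<eta> x x = 0 \<and> \<kappa> x x = 0"
proof -
  interpret \<eta>: hermitian_form \<eta> by fact
  interpret \<kappa>: hermitian_form \<kappa> by fact
  obtain T where T: "orthonormal T" "vec.span T = vec.span S"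
    "\<forall>v\<in>T. \<forall>w\<in>T. v \<noteq> w \<longrightarrow> \<eta> v w = 0"
    using \<eta>.diagonalization[of "vec.span S"] by auto
  have fin: "finite T" using T(1) by (rule orthonormalD)
  have "card T = card S"
    using orthonormal_card[OF T(1)] orthonormal_card[OF S(1)] T(2) by simp
  then have "card T > 0"
    using S(2) orthonormalD(1)[OF S(1)] by (simp add: card_gt_0_iff)
  have trT: "trace_on \<eta> T = 0" "trace_on \<kappa> T = 0"
    using \<eta>.trace_on_cong_span[OF T(1) S(1) T(2)] \<kappa>.trace_on_cong_span[OF T(1) S(1) T(2)] tr by auto
  obtain u where u: "\<forall>v. cmod (u v) = 1"
    "\<kappa> (\<Sum>v\<in>T. u v *s v) (\<Sum>v\<in>T. u v *s v) = trace_on \<kappa> T"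
    using \<kappa>.sum_of_phases[OF fin] by blast
  define x where "x = (\<Sum>v\<in>T. u v *s v)"
  have uu: "u v * cnj (u v) = 1" for v using u(1) complex_norm_square[of "u v"] by simp
  have "\<eta> x x = (\<Sum>v\<in>T. \<Sum>w\<in>T. u v * cnj (u w) * \<eta> v w)"
    unfolding x_def by (rule \<eta>.sum_sum)
  also have "\<dots> = (\<Sum>v\<in>T. \<Sum>w\<in>T. if v = w then \<eta> v w else 0)"
    using T(3) uu by (intro sum.cong refl) auto
  also have "\<dots> = trace_on \<eta> T" using fin by (simp add: trace_on_def)
  finally have ex: "\<eta> x x = 0" using trT by simp
  have kx: "\<kappa> x x = 0" using u(2) trT by (simp add: x_def)
  have "norm x = L2_set (\<lambda>v. 1) T"
    unfolding x_def norm_sum_orthonormal[OF T(1)] using u(1) by simp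
  then have nx: "norm x > 0" using \<open>card T > 0\<close> by (simp add: L2_set_def)
  have xS: "x \<in> vec.span S"
    unfolding T(2)[symmetric] x_def by (intro vec.span_sum vec.span_scale vec.span_base)
  show ?thesis
    by (rule bexI[of _ "of_real (1 / norm x) *s x"])
       (use nx xS ex kx in \<open>auto simp: norm_scale norm_divide \<eta>.expand \<kappa>.expand vec.span_scale\<close>)
qed

section \<open>Ordering numbers so that partial sums stay small\<close>

text \<open>Greedy: as long as the running sum is nonnegative, take a nonpositive summand, and conversely. The
offset \<open>s\<close> is the running sum at which the induction continues.\<close>

lemma ordering_with_small_partial_sums:
  fixes f :: "'a \<Rightarrow> real"
  assumes "finite R" "\<And>x. x \<in> R \<Longrightarrow> \<bar>f x\<bar> \<le> c" "\<bar>s\<bar> \<le> c" "s + sum f R = 0"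
  shows "\<exists>xs. distinct xs \<and> set xs = R \<and> (\<forall>k\<le>length xs. \<bar>s + (\<Sum>i<k. f (xs ! i))\<bar> \<le> c)"
  using assms
proof (induction "card R" arbitrary: R s)
  case 0
  then show ?case by (intro exI[of _ "[]"]) auto
next
  case (Suc n)
  have ne: "R \<noteq> {}" using Suc.hyps by auto
  have "\<exists>x\<in>R. \<bar>s + f x\<bar> \<le> c"
  proof (cases "s \<ge> 0")
    case True
    have "\<exists>x\<in>R. f x \<le> 0"
    proof (rule ccontr)
      assume "\<not> (\<exists>x\<in>R. f x \<le> 0)"
      then have "sum f R > 0" using ne Suc.prems by (intro sum_pos) auto
      then show False using True Suc.prems by simp
    qed
    then obtain x where "x \<in> R" "f x \<le> 0" by blast
    moreover have "\<bar>f x\<bar> \<le> c" using Suc.prems \<open>x \<in> R\<close> by blast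
    ultimately show ?thesis using True Suc.prems(3) by (intro bexI[of _ x]) auto
  next
    case False
    have "\<exists>x\<in>R. f x \<ge> 0"
    proof (rule ccontr)
      assume "\<not> (\<exists>x\<in>R. f x \<ge> 0)"
      then have "(\<Sum>x\<in>R. - f x) > 0" using ne Suc.prems by (intro sum_pos) auto
      then show False using False Suc.prems by (simp add: sum_negf)
    qed
    then obtain x where "x \<in> R" "f x \<ge> 0" by blast
    moreover have "\<bar>f x\<bar> \<le> c" using Suc.prems \<open>x \<in> R\<close> by blast
    ultimately show ?thesis using False Suc.prems(3) by (intro bexI[of _ x]) auto
  qed
  then obtain x where x: "x \<in> R" "\<bar>s + f x\<bar> \<le> c" by blast
  have "sum f R = f x + sum f (R - {x})" using x Suc.prems by (simp add: sum.remove)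
  then have "\<exists>xs. distinct xs \<and> set xs = R - {x} \<and>
      (\<forall>k\<le>length xs. \<bar>(s + f x) + (\<Sum>i<k. f (xs ! i))\<bar> \<le> c)"
    using Suc.hyps(2) Suc.prems x by (intro Suc.hyps(1)) auto
  then obtain xs where xs: "distinct xs" "set xs = R - {x}"
    "\<forall>k\<le>length xs. \<bar>(s + f x) + (\<Sum>i<k. f (xs ! i))\<bar> \<le> c" by blast
  have "\<bar>s + (\<Sum>i<k. f ((x # xs) ! i))\<bar> \<le> c" if "k \<le> length (x # xs)" for k
  proof (cases k)
    case (Suc j)
    then show ?thesis using that xs(3) unfolding Suc sum.lessThan_Suc_shift by (auto simp: add.assoc)
  qed (use Suc.prems in simp)
  then show ?case using xs x by (intro exI[of _ "x # xs"]) auto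
qed

section \<open>Orthogonal decompositions\<close>

text \<open>A decomposition of the span of \<open>S\<close> into mutually orthogonal subspaces, each presented by an orthonormal
basis. The set \<open>S\<close> matters only through its span.\<close>

definition orthogonal_decomposition :: "(complex^'n) set set \<Rightarrow> (complex^'n) set \<Rightarrow> bool" where
  "orthogonal_decomposition P S \<longleftrightarrow>
     finite P \<and> disjoint P \<and> orthonormal (\<Union>P) \<and> vec.span (\<Union>P) = vec.span S"

lemma orthogonal_decompositionD:
  assumes "orthogonal_decomposition P S"
  shows "finite P" "disjoint P" "orthonormal (\<Union>P)" "vec.span (\<Union>P) = vec.span S"
    and "\<And>T. T \<in> P \<Longrightarrow> orthonormal T"
    and "\<And>T. T \<in> P \<Longrightarrow> vec.span T \<subseteq> vec.span S"
proof -
  show *: "finite P" "disjoint P" "orthonormal (\<Union>P)" "vec.span (\<Union>P) = vec.span S"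
    using assms by (auto simp: orthogonal_decomposition_def)
  show "orthonormal T" "vec.span T \<subseteq> vec.span S" if "T \<in> P" for T
    using orthonormal_subset[OF *(3), of T] vec.span_mono[of T "\<Union>P"] *(4) that by auto
qed

lemma decomposition_spans_orthogonal:
  assumes "orthogonal_decomposition P S" "T \<in> P" "U \<in> P" "T \<noteq> U"
    and "x \<in> vec.span T" "y \<in> vec.span U"
  shows "cdot x y = 0"
proof (rule span_orthogonal_span[OF assms(5,6)])
  fix v w assume "v \<in> T" "w \<in> U"
  moreover have "T \<inter> U = {}"
    using orthogonal_decompositionD(2)[OF assms(1)] assms by (simp add: disjointD)
  ultimately have "v \<noteq> w" "v \<in> \<Union>P" "w \<in> \<Union>P" using assms by auto
  then show "cdot v w = 0"
    using orthonormalD(2)[OF orthogonal_decompositionD(3)[OF assms(1)], of v w] by simp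
qed

lemma decomposition_change_bases:
  assumes P: "orthogonal_decomposition P S"
    and f: "\<And>T. T \<in> P \<Longrightarrow> orthonormal (f T)" "\<And>T. T \<in> P \<Longrightarrow> vec.span (f T) = vec.span T"
  shows "orthonormal (\<Union>T\<in>P. f T)" "vec.span (\<Union>T\<in>P. f T) = vec.span S"
    and "\<And>T U. T \<in> P \<Longrightarrow> U \<in> P \<Longrightarrow> T \<noteq> U \<Longrightarrow> f T \<inter> f U = {}"
proof -
  note PD = orthogonal_decompositionD[OF P]
  have orth: "cdot v w = 0" if "T \<in> P" "U \<in> P" "T \<noteq> U" "v \<in> f T" "w \<in> f U" for T U v w
    using decomposition_spans_orthogonal[OF P that(1-3)] f(2) that vec.span_base by blast
  show disj: "f T \<inter> f U = {}" if "T \<in> P" "U \<in> P" "T \<noteq> U" for T U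
  proof (rule ccontr)
    assume "f T \<inter> f U \<noteq> {}"
    then obtain v where "v \<in> f T" "v \<in> f U" by blast
    then show False
      using orth[OF that, of v v] orthonormalD(2)[OF f(1), of T v v] that by simp
  qed
  show "orthonormal (\<Union>T\<in>P. f T)"
    unfolding orthonormal_def
  proof (intro conjI ballI)
    show "finite (\<Union>T\<in>P. f T)" using PD(1) f(1) by (auto simp: orthonormal_def)
  next
    fix v w assume "v \<in> (\<Union>T\<in>P. f T)" "w \<in> (\<Union>T\<in>P. f T)"
    then obtain T U where TU: "T \<in> P" "U \<in> P" "v \<in> f T" "w \<in> f U" by blast
    show "cdot v w = of_bool (v = w)"
    proof (cases "T = U")
      case True
      then show ?thesis using orthonormalD(2)[OF f(1)] TU by blast
    next
      case False
      then have "v \<noteq> w" using disj TU by blast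
      then show ?thesis using orth[OF TU(1,2) False TU(3,4)] by simp
    qed
  qed
  show "vec.span (\<Union>T\<in>P. f T) = vec.span S"
    unfolding PD(4)[symmetric]
  proof
    show "vec.span (\<Union>T\<in>P. f T) \<subseteq> vec.span (\<Union>P)"
    proof (rule vec.span_minimal)
      show "(\<Union>T\<in>P. f T) \<subseteq> vec.span (\<Union>P)"
        using f(2) vec.span_base vec.span_mono[of _ "\<Union>P"] by blast
    qed simp
    show "vec.span (\<Union>P) \<subseteq> vec.span (\<Union>T\<in>P. f T)"
    proof (rule vec.span_minimal)
      show "\<Union>P \<subseteq> vec.span (\<Union>T\<in>P. f T)"
        using f(2) vec.span_base vec.span_mono[of "f _" "\<Union>T\<in>P. f T"] by blast
    qed simp
  qed
qed

lemma decomposition_refine: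
  assumes P: "orthogonal_decomposition P S"
    and Q: "\<And>T. T \<in> P \<Longrightarrow> orthogonal_decomposition (Q T) T"
  shows "orthogonal_decomposition (\<Union>T\<in>P. Q T) S"
proof -
  note QD = orthogonal_decompositionD[OF Q]
  have *: "orthonormal (\<Union>T\<in>P. \<Union>(Q T))" "vec.span (\<Union>T\<in>P. \<Union>(Q T)) = vec.span S"
    "\<And>T U. T \<in> P \<Longrightarrow> U \<in> P \<Longrightarrow> T \<noteq> U \<Longrightarrow> \<Union>(Q T) \<inter> \<Union>(Q U) = {}"
    by (rule decomposition_change_bases[OF P, of "\<lambda>T. \<Union>(Q T)"]; simp add: QD(3,4))+
  have eq: "\<Union>(\<Union>T\<in>P. Q T) = (\<Union>T\<in>P. \<Union>(Q T))" by blast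
  have "disjoint (\<Union>T\<in>P. Q T)"
  proof (rule disjointI)
    fix X Y assume "X \<in> (\<Union>T\<in>P. Q T)" "Y \<in> (\<Union>T\<in>P. Q T)" "X \<noteq> Y"
    then obtain T U where TU: "T \<in> P" "U \<in> P" "X \<in> Q T" "Y \<in> Q U" by blast
    show "X \<inter> Y = {}"
    proof (cases "T = U")
      case True
      then show ?thesis using QD(2)[OF TU(1)] TU \<open>X \<noteq> Y\<close> by (simp add: disjointD)
    next
      case False
      then show ?thesis using *(3)[OF TU(1,2)] TU(3,4) by blast
    qed
  qed
  then show ?thesis
    using * QD(1) orthogonal_decompositionD(1)[OF P] by (auto simp: orthogonal_decomposition_def eq)
qed

lemma two_part_decomposition:
  assumes "orthonormal (X \<union> R)" "X \<inter> R = {}"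
  shows "orthogonal_decomposition {X, R} (X \<union> R)"
  using assms by (auto simp: orthogonal_decomposition_def disjoint_def)

section \<open>Splitting one Hermitian form while balancing another\<close>

lemma sum_pairs:
  fixes f :: "nat \<Rightarrow> complex"
  shows "(\<Sum>t<m. f (2 * t) + f (2 * t + 1)) = (\<Sum>t<2 * m. f t)"
  by (induction m) (auto simp: algebra_simps)

lemma sum_lessThan_add:
  fixes f :: "nat \<Rightarrow> 'a::comm_monoid_add"
  shows "(\<Sum>i<n + l. f i) = (\<Sum>i<n. f i) + (\<Sum>i<l. f (n + i))"
  by (induction l) (auto simp: add.assoc)

lemma (in sesquilinear) average_of_pair:
  "\<alpha> (of_real (1 / sqrt 2) *s (a + g *s b)) (of_real (1 / sqrt 2) *s (a' + g' *s b'))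
    = (\<alpha> a a' + cnj g' * \<alpha> a b' + g * \<alpha> b a' + g * cnj g' * \<alpha> b b') / 2"
proof -
  have "complex_of_real (1 / sqrt 2) * of_real (1 / sqrt 2) = 1 / 2"
    by (simp flip: of_real_mult)
  then show ?thesis
    by (simp only: expand complex_cnj_complex_of_real mult.assoc[symmetric]) (simp add: algebra_simps)
qed

text \<open>Let \<open>\<eta>\<close> be diagonal with eigenvalues \<open>a\<^sub>0, a\<^sub>1, \<dots>\<close> in the basis \<open>v\<close>. The vectors
\<open>(v\<^sub>2\<^sub>t \<plusminus> u v\<^sub>2\<^sub>t\<^sub>+\<^sub>1) / \<surd>2\<close> with a common phase \<open>u\<close> span two orthogonal subspaces; on each of them \<open>\<eta>\<close> is still
diagonal, with the averages \<open>(a\<^sub>2\<^sub>t + a\<^sub>2\<^sub>t\<^sub>+\<^sub>1) / 2\<close> as eigenvalues, whatever \<open>u\<close> is. The traces of \<open>\<kappa>\<close> on the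
two subspaces differ by a multiple of \<open>Re (u z)\<close> for some complex \<open>z\<close>, so a suitable \<open>u\<close> makes both equal to half of the
trace, that is, zero. Doing this \<open>p\<close> times produces \<open>2\<^sup>p\<close> subspaces on which \<open>\<eta>\<close> is diagonal with the
averages of \<open>2\<^sup>p\<close> consecutive eigenvalues.\<close>

lemma halving_sequences:
  fixes v :: "nat \<Rightarrow> complex^'n" and m :: nat
  assumes "sesquilinear \<eta>" "hermitian_form \<kappa>"
    and "\<forall>i<2^p * m. \<forall>j<2^p * m. cdot (v i) (v j) = of_bool (i = j)"
    and "\<forall>i<2^p * m. \<forall>j<2^p * m. i \<noteq> j \<longrightarrow> \<eta> (v i) (v j) = 0"
    and "(\<Sum>i<2^p * m. \<kappa> (v i) (v i)) = 0"
  shows "\<exists>w :: nat \<Rightarrow> nat \<Rightarrow> complex^'n. (\<forall>k<2^p. \<forall>t<m. \<forall>k'<2^p. \<forall>t'<m. cdot (w k t) (w k' t') = of_bool (k = k' \<and> t = t')) \<and>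
     (\<forall>k<2^p. \<forall>t<m. w k t \<in> vec.span (v ` {..<2^p * m})) \<and>
     (\<forall>k<2^p. \<forall>t<m. \<forall>t'<m. t \<noteq> t' \<longrightarrow> \<eta> (w k t) (w k t') = 0) \<and>
     (\<forall>k<2^p. \<forall>t<m. \<eta> (w k t) (w k t) = (\<Sum>i<2^p. \<eta> (v (2^p * t + i)) (v (2^p * t + i))) / 2^p) \<and>
     (\<forall>k<2^p. (\<Sum>t<m. \<kappa> (w k t) (w k t)) = 0)"
  using assms
proof (induction p arbitrary: m)
  case 0
  then show ?case by (intro exI[of _ "\<lambda>_. v"]) (auto intro!: vec.span_base)
next
  case (Suc p)
  interpret \<eta>: sesquilinear \<eta> by fact
  interpret \<kappa>: hermitian_form \<kappa> by fact
  have N: "2^p * (2 * m) = 2^Suc p * m" by simp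
  from Suc.IH[of "2 * m", unfolded N, OF Suc.prems] obtain w :: "nat \<Rightarrow> nat \<Rightarrow> complex^'n" where w0:
    "\<forall>k<2^p. \<forall>t<2*m. \<forall>k'<2^p. \<forall>t'<2*m. cdot (w k t) (w k' t') = of_bool (k = k' \<and> t = t')"
    "\<forall>k<2^p. \<forall>t<2*m. w k t \<in> vec.span (v ` {..<2^Suc p * m})"
    "\<forall>k<2^p. \<forall>t<2*m. \<forall>t'<2*m. t \<noteq> t' \<longrightarrow> \<eta> (w k t) (w k t') = 0"
    "\<forall>k<2^p. \<forall>t<2*m. \<eta> (w k t) (w k t) = (\<Sum>i<2^p. \<eta> (v (2^p * t + i)) (v (2^p * t + i))) / 2^p"
    "\<forall>k<2^p. (\<Sum>t<2*m. \<kappa> (w k t) (w k t)) = 0"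
    by (elim exE conjE) (rule that; assumption)
  note w = w0[rule_format]
  have "\<forall>k. \<exists>c. cmod c = 1 \<and> Re (c * (\<Sum>t<m. \<kappa> (w k (2*t+1)) (w k (2*t)))) = 0"
    using phase_exists by blast
  then obtain u where u: "\<And>k. cmod (u k) = 1"
    "\<And>k. Re (u k * (\<Sum>t<m. \<kappa> (w k (2*t+1)) (w k (2*t)))) = 0" by metis
  \<comment> \<open>The new subspaces \<open>2 j\<close> and \<open>2 j + 1\<close> are the \<open>+\<close> and \<open>-\<close> halves of the old subspace \<open>j\<close>.\<close>
  define g where "g k = (-1)^k * u (k div 2)" for k
  have gg: "g k * cnj (g k') = (if even k = even k' then 1 else -1)" if "k div 2 = k' div 2" for k k'
    using u(1)[of "k div 2"] complex_norm_square[of "u (k div 2)"] that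
    by (auto simp: g_def minus_one_power_iff)
  have gZ: "Re (g k * (\<Sum>t<m. \<kappa> (w (k div 2) (2*t+1)) (w (k div 2) (2*t)))) = 0" for k
    using u(2)[of "k div 2"] by (simp add: g_def minus_one_power_iff)
  define w' where "w' k t = of_real (1 / sqrt 2) *s (w (k div 2) (2*t) + g k *s w (k div 2) (2*t+1))" for k t
  have lt: "k div 2 < 2^p" "2*t < 2*m" "2*t+1 < 2*m" if "k < 2^Suc p" "t < m" for k t :: nat
    using that by auto
  have eqk: "k = k' \<longleftrightarrow> k div 2 = k' div 2 \<and> even k = even k'" for k k' :: nat
    by (metis even_two_times_div_two odd_two_times_div_two_succ)
  have c1: "cdot (w' k t) (w' k' t') = of_bool (k = k' \<and> t = t')"
    if "k < 2^Suc p" "t < m" "k' < 2^Suc p" "t' < m" for k t k' t'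
  proof -
    note l = lt[OF that(1,2)] lt[OF that(3,4)]
    have "2 * t \<noteq> 2 * t' + 1" "2 * t + 1 \<noteq> 2 * t'" by presburger+
    then have "cdot (w' k t) (w' k' t') =
        (of_bool (k div 2 = k' div 2 \<and> t = t') + g k * cnj (g k') * of_bool (k div 2 = k' div 2 \<and> t = t')) / 2"
      unfolding w'_def cdot.average_of_pair using l by (simp add: w(1))
    then show ?thesis
      using gg[of k k'] eqk[of k k'] by (cases "k div 2 = k' div 2"; cases "t = t'") (auto split: if_splits)
  qed
  have c2: "w' k t \<in> vec.span (v ` {..<2^Suc p * m})" if "k < 2^Suc p" "t < m" for k t
    unfolding w'_def by (intro vec.span_scale vec.span_add w(2) lt[OF that])
  have c3: "\<eta> (w' k t) (w' k t') = 0" if "k < 2^Suc p" "t < m" "t' < m" "t \<noteq> t'" for k t t'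
  proof -
    have "2 * t \<noteq> 2 * t' + 1" "2 * t + 1 \<noteq> 2 * t'" by presburger+
    then show ?thesis
      unfolding w'_def \<eta>.average_of_pair using lt[OF that(1,2)] lt[OF that(1,3)] that(4) by (simp add: w(3))
  qed
  have c4: "\<eta> (w' k t) (w' k t)
      = (\<Sum>i<2^Suc p. \<eta> (v (2^Suc p * t + i)) (v (2^Suc p * t + i))) / 2^Suc p"
    if "k < 2^Suc p" "t < m" for k t
  proof -
    note l = lt[OF that]
    let ?a = "\<lambda>i. \<eta> (v i) (v i)"
    have e: "2^p * (2*t) = 2^Suc p * t" "2^p * (2*t+1) + i = 2^Suc p * t + (2^p + i)" for i
      by (auto simp: algebra_simps)
    have "\<eta> (w' k t) (w' k t) = (\<eta> (w (k div 2) (2*t)) (w (k div 2) (2*t)) + \<eta> (w (k div 2) (2*t+1)) (w (k div 2) (2*t+1))) / 2"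
      unfolding w'_def \<eta>.average_of_pair using l gg[of k k] by (simp add: w(3))
    also have "\<dots> = ((\<Sum>i<2^p. ?a (2^Suc p * t + i)) / 2^p + (\<Sum>i<2^p. ?a (2^Suc p * t + (2^p + i))) / 2^p) / 2"
      unfolding w(4)[OF l(1,2)] w(4)[OF l(1,3)] e ..
    also have "\<dots> = ((\<Sum>i<2^p. ?a (2^Suc p * t + i)) + (\<Sum>i<2^p. ?a (2^Suc p * t + (2^p + i)))) / 2^Suc p"
      by (simp add: field_simps)
    also have "\<dots> = (\<Sum>i<2^p + 2^p. ?a (2^Suc p * t + i)) / 2^Suc p"
      by (simp only: sum_lessThan_add)
    finally show ?thesis by (simp only: power_Suc mult_2)
  qed
  have c5: "(\<Sum>t<m. \<kappa> (w' k t) (w' k t)) = 0" if k: "k < 2^Suc p" for k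
  proof -
    let ?a = "\<lambda>t. w (k div 2) (2*t)" and ?b = "\<lambda>t. w (k div 2) (2*t+1)"
    let ?Z = "\<Sum>t<m. \<kappa> (?b t) (?a t)"
    have "\<kappa> (w' k t) (w' k t) = ((\<kappa> (?a t) (?a t) + \<kappa> (?b t) (?b t)) + (g k * \<kappa> (?b t) (?a t) + cnj (g k * \<kappa> (?b t) (?a t)))) / 2" for t
      unfolding w'_def \<kappa>.average_of_pair using gg[of k k] \<kappa>.hermitian[of "?b t" "?a t"] by (simp add: algebra_simps)
    then have "(\<Sum>t<m. \<kappa> (w' k t) (w' k t)) =
        ((\<Sum>t<m. \<kappa> (?a t) (?a t) + \<kappa> (?b t) (?b t)) + (g k * ?Z + cnj (g k * ?Z))) / 2"
      by (simp only: sum_divide_distrib[symmetric] sum.distrib sum_distrib_left cnj_sum)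
    also have "(\<Sum>t<m. \<kappa> (?a t) (?a t) + \<kappa> (?b t) (?b t)) = 0"
      using sum_pairs[of "\<lambda>t. \<kappa> (w (k div 2) t) (w (k div 2) t)" m] w(5)[of "k div 2"] k by auto
    also have "g k * ?Z + cnj (g k * ?Z) = 0"
      using gZ[of k] by (simp only: complex_add_cnj) simp
    finally show ?thesis by simp
  qed
  show ?case
    by (intro exI[of _ w'] conjI allI impI; (rule c1 c2 c3 c4 c5; assumption))
qed

text \<open>If the eigenvalues of \<open>\<eta>\<close> are ordered with all partial sums in \<open>[-c, c]\<close>, then \<open>2\<^sup>p\<close> consecutive ones sum to at
most \<open>2 c\<close> in modulus, so the averages are at most \<open>2 c / 2\<^sup>p\<close>: for a single Hermitian form,
\<open>2\<^sup>p\<close> blocks reduce the norm by a factor of order \<open>2\<^sup>p\<close>, while the traces of both forms stay zero.\<close>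

lemma halving:
  fixes S :: "(complex^'n) set"
  assumes "hermitian_form \<eta>" "hermitian_form \<kappa>" and S: "orthonormal S" and card: "card S = 2^p * m"
    and bd: "bounded_on \<eta> (vec.span S) c" "c \<ge> 0" and tr: "trace_on \<eta> S = 0" "trace_on \<kappa> S = 0"
  shows "\<exists>P. orthogonal_decomposition P S \<and> card P \<le> 2^p \<and>
    (\<forall>T\<in>P. card T = m \<and> trace_on \<eta> T = 0 \<and> trace_on \<kappa> T = 0 \<and> bounded_on \<eta> (vec.span T) (2 * c / 2^p))"
proof -
  interpret \<eta>: hermitian_form \<eta> by fact
  interpret \<kappa>: hermitian_form \<kappa> by fact
  obtain D where D: "orthonormal D" "vec.span D = vec.span S"
    "\<forall>v\<in>D. \<forall>w\<in>D. v \<noteq> w \<longrightarrow> \<eta> v w = 0"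
    using \<eta>.diagonalization[of "vec.span S"] by auto
  have trD: "trace_on \<eta> D = 0" "trace_on \<kappa> D = 0"
    using \<eta>.trace_on_cong_span[OF D(1) S D(2)] \<kappa>.trace_on_cong_span[OF D(1) S D(2)] tr by auto
  have cardD: "card D = 2^p * m"
    using orthonormal_card[OF D(1)] orthonormal_card[OF S] D(2) card by simp
  have "\<bar>Re (\<eta> v v)\<bar> \<le> c" if "v \<in> D" for v
  proof -
    have "v \<in> vec.span S" using that D(2) vec.span_base by blast
    then have "cmod (\<eta> v v) \<le> c"
      using bd(1) norm_orthonormal[OF D(1) that] by (force simp: bounded_on_def)
    then show ?thesis using abs_Re_le_cmod[of "\<eta> v v"] by linarith
  qed
  moreover have "0 + (\<Sum>v\<in>D. Re (\<eta> v v)) = 0" using trD(1) by (simp add: trace_on_def complex_eq_iff)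
  moreover have "\<bar>0::real\<bar> \<le> c" using bd(2) by simp
  ultimately obtain xs where xs: "distinct xs" "set xs = D"
    "\<forall>k\<le>length xs. \<bar>\<Sum>i<k. Re (\<eta> (xs ! i) (xs ! i))\<bar> \<le> c"
    using ordering_with_small_partial_sums[of D "\<lambda>v. Re (\<eta> v v)" c 0, OF orthonormalD(1)[OF D(1)]]
    by (metis (no_types, lifting) add_0)
  let ?N = "2^p * m" and ?v = "\<lambda>i. xs ! i"
  have len: "length xs = ?N" using xs cardD distinct_card by fastforce
  have img: "?v ` {..<?N} = D" using xs(2) len by (auto simp: set_conv_nth)
  have inj: "inj_on ?v {..<?N}" using xs(1) len by (auto simp: inj_on_def nth_eq_iff_index_eq)
  have sumD: "(\<Sum>i<?N. f (?v i)) = sum f D" for f :: "_ \<Rightarrow> complex"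
    using sum.reindex[OF inj, of f] img by simp
  have vD: "?v i \<in> D" if "i < ?N" for i using that img by blast
  have vinj: "?v i = ?v j \<longleftrightarrow> i = j" if "i < ?N" "j < ?N" for i j
    using that inj by (auto dest: inj_onD)
  have D1: "\<forall>i<?N. \<forall>j<?N. cdot (?v i) (?v j) = of_bool (i = j)"
    using orthonormalD(2)[OF D(1) vD vD] vinj by simp
  have D2: "\<forall>i<?N. \<forall>j<?N. i \<noteq> j \<longrightarrow> \<eta> (?v i) (?v j) = 0"
    using D(3) vD vinj by simp
  have D3: "(\<Sum>i<?N. \<kappa> (?v i) (?v i)) = 0" using trD(2) sumD[of "\<lambda>x. \<kappa> x x"] by (simp add: trace_on_def)
  from halving_sequences[OF \<eta>.sesquilinear_axioms assms(2), of p m ?v, OF D1 D2 D3, unfolded img]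
  obtain w :: "nat \<Rightarrow> nat \<Rightarrow> complex^'n" where w0:
    "\<forall>k<2^p. \<forall>t<m. \<forall>k'<2^p. \<forall>t'<m. cdot (w k t) (w k' t') = of_bool (k = k' \<and> t = t')"
    "\<forall>k<2^p. \<forall>t<m. w k t \<in> vec.span D"
    "\<forall>k<2^p. \<forall>t<m. \<forall>t'<m. t \<noteq> t' \<longrightarrow> \<eta> (w k t) (w k t') = 0"
    "\<forall>k<2^p. \<forall>t<m. \<eta> (w k t) (w k t) = (\<Sum>i<2^p. \<eta> (?v (2^p * t + i)) (?v (2^p * t + i))) / 2^p"
    "\<forall>k<2^p. (\<Sum>t<m. \<kappa> (w k t) (w k t)) = 0"
    by (elim exE conjE) (rule that; assumption)
  note w = w0[rule_format]
  have winj: "w k t = w k' t' \<longleftrightarrow> k = k' \<and> t = t'" if "k < 2^p" "t < m" "k' < 2^p" "t' < m" for k t k' t'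
  proof
    assume "w k t = w k' t'"
    then have "cdot (w k t) (w k' t') = cdot (w k t) (w k t)" by simp
    then show "k = k' \<and> t = t'" unfolding w(1)[OF that] w(1)[OF that(1,2,1,2)] by (auto split: if_splits)
  qed auto
  define T where "T k = w k ` {..<m}" for k
  define P where "P = T ` {..<2^p}"
  have injk: "inj_on (w k) {..<m}" if "k < 2^p" for k using winj that by (auto simp: inj_on_def)
  have cardT: "card (T k) = m" if "k < 2^p" for k
    using card_image[OF injk[OF that]] by (simp add: T_def)
  have UP: "\<Union>P = (\<lambda>(k, t). w k t) ` ({..<2^p} \<times> {..<m})" by (auto simp: P_def T_def)
  have oP: "orthonormal (\<Union>P)"
    unfolding orthonormal_def UP by (auto simp: w(1) winj)
  have "inj_on (\<lambda>(k, t). w k t) ({..<2^p} \<times> {..<m})" by (auto simp: inj_on_def winj)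
  then have cUP: "card (\<Union>P) = 2^p * m" unfolding UP by (simp add: card_image card_cartesian_product)
  have "\<Union>P \<subseteq> vec.span D" using w(2) by (auto simp: UP)
  then have "vec.span (\<Union>P) = vec.span D"
    using orthonormal_span_eqI[OF oP] orthonormalD(1)[OF D(1)] cardD cUP by simp
  moreover have "disjoint P" unfolding disjoint_def P_def T_def by (auto simp: winj)
  ultimately have dec: "orthogonal_decomposition P S"
    using oP D(2) by (simp add: orthogonal_decomposition_def P_def)
  have sumT: "trace_on \<beta> (T k) = (\<Sum>t<m. \<beta> (w k t) (w k t))" if "k < 2^p" for k \<beta>
    unfolding trace_on_def T_def using sum.reindex[OF injk[OF that], of "\<lambda>x. \<beta> x x"] by simp
  have group: "(\<Sum>t<m. \<Sum>i<2^p. f (2^p * t + i)) = (\<Sum>i<?N. f i)" for f :: "nat \<Rightarrow> complex"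
  proof (induction m)
    case (Suc m)
    have "2^p * Suc m = 2^p * m + 2^p" by simp
    then show ?case using Suc by (simp only: sum_lessThan_add sum.lessThan_Suc)
  qed simp
  have "trace_on \<eta> (T k) = 0" if "k < 2^p" for k
  proof -
    have "trace_on \<eta> (T k) = (\<Sum>t<m. \<Sum>i<2^p. \<eta> (?v (2^p * t + i)) (?v (2^p * t + i))) / 2^p"
      using that by (simp add: sumT w(4) sum_divide_distrib)
    also have "\<dots> = trace_on \<eta> D / 2^p"
      using group[of "\<lambda>i. \<eta> (?v i) (?v i)"] sumD[of "\<lambda>x. \<eta> x x"] by (simp add: trace_on_def)
    finally show ?thesis using trD by simp
  qed
  moreover have "trace_on \<kappa> (T k) = 0" if "k < 2^p" for k
    using that by (simp add: sumT w(5))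
  moreover have "bounded_on \<eta> (vec.span (T k)) (2 * c / 2^p)" if k: "k < 2^p" for k
  proof (rule \<eta>.bounded_on_diagonal)
    show "orthonormal (T k)" using orthogonal_decompositionD(5)[OF dec] k by (auto simp: P_def)
    show "\<eta> x y = 0" if "x \<in> T k" "y \<in> T k" "x \<noteq> y" for x y
      using that k w(3) by (auto simp: T_def)
    show "2 * c / 2^p \<ge> 0" using bd(2) by simp
    fix x assume "x \<in> T k"
    then obtain t where t: "t < m" "x = w k t" by (auto simp: T_def)
    let ?a = "\<lambda>i. Re (\<eta> (?v i) (?v i))"
    have "\<eta> x x = of_real (Re (\<eta> x x))" by (rule \<eta>.diagonal_real)
    then have "cmod (\<eta> x x) = \<bar>Re (\<eta> x x)\<bar>" by (metis norm_of_real)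
    also have "Re (\<eta> x x) = (\<Sum>i<2^p. ?a (2^p * t + i)) / 2^p"
    proof -
      have "(2::complex)^p = of_real (2^p)" by simp
      then show ?thesis unfolding t(2) w(4)[OF k t(1)] by (simp only: Re_divide_of_real Re_sum)
    qed
    also have "(\<Sum>i<2^p. ?a (2^p * t + i)) = (\<Sum>i<2^p * (t + 1). ?a i) - (\<Sum>i<2^p * t. ?a i)"
      by (simp only: distrib_left mult_1_right sum_lessThan_add add_diff_cancel_left')
    also have "\<bar>(\<dots>) / 2^p\<bar> \<le> 2 * c / 2^p"
    proof -
      have "2^p * (t + 1) \<le> ?N" using t(1) by (intro mult_le_mono2) simp
      moreover have "2^p * t \<le> ?N" using t(1) by (intro mult_le_mono2) simp
      ultimately have "\<bar>\<Sum>i<2^p * (t + 1). ?a i\<bar> \<le> c" "\<bar>\<Sum>i<2^p * t. ?a i\<bar> \<le> c"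
        using xs(3) len by auto
      then show ?thesis by (simp add: abs_divide divide_right_mono)
    qed
    finally show "cmod (\<eta> x x) \<le> 2 * c / 2^p" .
  qed
  moreover have "card P \<le> 2^p" using card_image_le[of "{..<2^p}" T] by (simp add: P_def)
  ultimately show ?thesis using dec cardT by (intro exI[of _ P]) (auto simp: P_def)
qed

section \<open>Paving in a suitable orthonormal basis\<close>

text \<open>Splitting off isotropic vectors adjusts the dimension of the rest, which has to be divisible by \<open>4\<^sup>p\<close>
for the halving to be applied, without spoiling the trace.\<close>

lemma peel_isotropic:
  fixes S :: "(complex^'n) set"
  assumes h: "hermitian_form \<eta>" "hermitian_form \<kappa>" and S: "orthonormal S"
    and tr: "trace_on \<eta> S = 0" "trace_on \<kappa> S = 0" and "s \<le> card S"
  shows "\<exists>X R. X \<inter> R = {} \<and> orthonormal (X \<union> R) \<and> vec.span (X \<union> R) = vec.span S \<and> card X = s \<and>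
    (\<forall>x\<in>X. \<eta> x x = 0 \<and> \<kappa> x x = 0) \<and> trace_on \<eta> R = 0 \<and> trace_on \<kappa> R = 0"
  using \<open>s \<le> card S\<close>
proof (induction s)
  case 0
  show ?case using S tr by - (rule exI[of _ "{}"], rule exI[of _ S], auto)
next
  case (Suc s)
  interpret \<eta>: hermitian_form \<eta> by fact
  interpret \<kappa>: hermitian_form \<kappa> by fact
  from Suc obtain X R where XR: "X \<inter> R = {}" "orthonormal (X \<union> R)" "vec.span (X \<union> R) = vec.span S"
    "card X = s" "\<forall>x\<in>X. \<eta> x x = 0 \<and> \<kappa> x x = 0" "trace_on \<eta> R = 0" "trace_on \<kappa> R = 0"
    by auto
  have fin: "finite X" "finite R" using orthonormalD(1)[OF XR(2)] by auto
  have oR: "orthonormal R" "orthonormal X" using orthonormal_subset[OF XR(2)] by auto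
  have "card (X \<union> R) = card S"
    using orthonormal_card[OF XR(2)] orthonormal_card[OF S] XR(3) by simp
  then have "R \<noteq> {}" using Suc.prems XR(4) by auto
  then obtain x where x: "x \<in> vec.span R" "norm x = 1" "\<eta> x x = 0" "\<kappa> x x = 0"
    using joint_isotropic_vector[OF h oR(1) _ XR(6,7)] by blast
  obtain T where T: "x \<notin> T" "orthonormal (insert x T)" "vec.span (insert x T) = vec.span R"
    using orthonormal_extend[OF x(1,2)] by blast
  have finT: "finite T" using orthonormalD(1)[OF T(2)] by simp
  have trT: "trace_on \<beta> T = trace_on \<beta> R" if "sesquilinear \<beta>" "\<beta> x x = 0" for \<beta>
    using sesquilinear.trace_on_cong_span[OF that(1) T(2) oR(1) T(3)] that(2) T(1) finT
    by (simp add: trace_on_def)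
  have "X \<noteq> R" using XR(1) \<open>R \<noteq> {}\<close> by auto
  define f where "f U = (if U = R then insert x T else U)" for U
  have f: "orthonormal (f U)" "vec.span (f U) = vec.span U" if "U \<in> {X, R}" for U
    using that T oR by (auto simp: f_def)
  have fX: "f X = X" "f R = insert x T" using \<open>X \<noteq> R\<close> by (auto simp: f_def)
  note dec = two_part_decomposition[OF XR(2,1)]
  have "orthonormal (\<Union>U\<in>{X, R}. f U)" "vec.span (\<Union>U\<in>{X, R}. f U) = vec.span (X \<union> R)"
    "f X \<inter> f R = {}"
    using decomposition_change_bases[OF dec f] \<open>X \<noteq> R\<close> by auto
  then have *: "orthonormal (X \<union> insert x T)" "vec.span (X \<union> insert x T) = vec.span (X \<union> R)"
    "X \<inter> insert x T = {}"
    unfolding fX by (simp_all add: fX)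
  show ?case
  proof (rule exI[of _ "insert x X"], rule exI[of _ T], intro conjI)
    show "insert x X \<inter> T = {}" using T(1) *(3) by auto
    show "orthonormal (insert x X \<union> T)" using *(1) by simp
    show "vec.span (insert x X \<union> T) = vec.span S" using *(2) XR(3) by simp
    show "card (insert x X) = Suc s" using *(3) fin XR(4) by simp
    show "\<forall>y\<in>insert x X. \<eta> y y = 0 \<and> \<kappa> y y = 0" using XR(5) x by auto
    show "trace_on \<eta> T = 0" "trace_on \<kappa> T = 0"
      using trT[OF \<eta>.sesquilinear_axioms x(3)] trT[OF \<kappa>.sesquilinear_axioms x(4)] XR by auto
  qed
qed

context sesquilinear
begin

definition re_part where "re_part x y = (\<alpha> x y + cnj (\<alpha> y x)) / 2"
definition im_part where "im_part x y = (\<alpha> x y - cnj (\<alpha> y x)) / (2 * \<i>)"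

lemma hermitian_re_part: "hermitian_form re_part"
  by unfold_locales (auto simp: re_part_def expand algebra_simps add_divide_distrib)

lemma hermitian_im_part: "hermitian_form im_part"
  by unfold_locales (auto simp: im_part_def expand algebra_simps add_divide_distrib diff_divide_distrib complex_eq_iff)

lemma re_part_plus_im_part: "\<alpha> x y = re_part x y + \<i> * im_part x y"
  by (simp add: re_part_def im_part_def field_simps)

lemma bounded_re_part: "bounded_on \<alpha> E c \<Longrightarrow> bounded_on re_part E c"
  unfolding bounded_on_def
proof (intro ballI)
  fix x y assume b: "\<forall>x\<in>E. \<forall>y\<in>E. cmod (\<alpha> x y) \<le> c * norm x * norm y" and "x \<in> E" "y \<in> E"
  then have "cmod (\<alpha> x y) \<le> c * norm x * norm y" "cmod (cnj (\<alpha> y x)) \<le> c * norm x * norm y"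
    by (auto simp: mult_ac)
  then show "cmod (re_part x y) \<le> c * norm x * norm y"
    using norm_triangle_ineq[of "\<alpha> x y" "cnj (\<alpha> y x)"] by (simp add: re_part_def norm_divide)
qed

lemma bounded_im_part: "bounded_on \<alpha> E c \<Longrightarrow> bounded_on im_part E c"
  unfolding bounded_on_def
proof (intro ballI)
  fix x y assume b: "\<forall>x\<in>E. \<forall>y\<in>E. cmod (\<alpha> x y) \<le> c * norm x * norm y" and "x \<in> E" "y \<in> E"
  then have "cmod (\<alpha> x y) \<le> c * norm x * norm y" "cmod (cnj (\<alpha> y x)) \<le> c * norm x * norm y"
    by (auto simp: mult_ac)
  then show "cmod (im_part x y) \<le> c * norm x * norm y"
    using norm_triangle_ineq4[of "\<alpha> x y" "cnj (\<alpha> y x)"] by (simp add: im_part_def norm_divide norm_mult)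
qed

lemma trace_on_parts:
  assumes "trace_on \<alpha> S = 0"
  shows "trace_on re_part S = 0" "trace_on im_part S = 0"
proof -
  have "trace_on re_part S = (trace_on \<alpha> S + cnj (trace_on \<alpha> S)) / 2"
    unfolding trace_on_def re_part_def cnj_sum sum.distrib[symmetric] sum_divide_distrib ..
  moreover have "trace_on im_part S = (trace_on \<alpha> S - cnj (trace_on \<alpha> S)) / (2 * \<i>)"
    unfolding trace_on_def im_part_def cnj_sum sum_subtractf[symmetric] sum_divide_distrib ..
  ultimately show "trace_on re_part S = 0" "trace_on im_part S = 0" using assms by auto
qed

text \<open>First \<open>2\<^sup>p\<close> blocks that make the real part small, then \<open>2\<^sup>p\<close> blocks inside each of them that make the
imaginary part small. The second step cannot increase the norm of the real part since it only compresses
further, and it keeps the trace of the real part zero.\<close>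

lemma paving_divisible:
  assumes S: "orthonormal S" and card: "card S = 4^p * m"
    and bd: "bounded_on re_part (vec.span S) c" "bounded_on im_part (vec.span S) c" "c \<ge> 0"
    and tr: "trace_on re_part S = 0" "trace_on im_part S = 0"
  shows "\<exists>P. orthogonal_decomposition P S \<and> card P \<le> 4^p \<and>
    (\<forall>T\<in>P. card T = m \<and> trace_on \<alpha> T = 0 \<and> bounded_on \<alpha> (vec.span T) (4 * c / 2^p))"
proof -
  have p4: "(4::nat)^p = 2^p * 2^p" by (simp add: power_mult_distrib[symmetric])
  then have "card S = 2^p * (2^p * m)" using card by simp
  from halving[OF hermitian_re_part hermitian_im_part S this bd(1,3) tr]
  obtain P where P: "orthogonal_decomposition P S" "card P \<le> 2^p"
    "\<And>T. T \<in> P \<Longrightarrow> card T = 2^p * m \<and> trace_on re_part T = 0 \<and> trace_on im_part T = 0 \<and>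
       bounded_on re_part (vec.span T) (2 * c / 2^p)"
    by blast
  have "\<exists>Q. orthogonal_decomposition Q T \<and> card Q \<le> 2^p \<and>
      (\<forall>U\<in>Q. card U = m \<and> trace_on im_part U = 0 \<and> trace_on re_part U = 0 \<and>
        bounded_on im_part (vec.span U) (2 * c / 2^p))" if T: "T \<in> P" for T
    using P(3)[OF T] orthogonal_decompositionD(5,6)[OF P(1) T] bd
    by (intro halving hermitian_re_part hermitian_im_part) (auto intro: bounded_on_subset)
  then obtain Q where Q: "\<And>T. T \<in> P \<Longrightarrow> orthogonal_decomposition (Q T) T"
    "\<And>T. T \<in> P \<Longrightarrow> card (Q T) \<le> 2^p"
    "\<And>T U. T \<in> P \<Longrightarrow> U \<in> Q T \<Longrightarrow> card U = m \<and> trace_on im_part U = 0 \<and> trace_on re_part U = 0 \<and>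
        bounded_on im_part (vec.span U) (2 * c / 2^p)"
    by metis
  have finP: "finite P" using orthogonal_decompositionD(1)[OF P(1)] .
  have "card (\<Union>T\<in>P. Q T) \<le> (\<Sum>T\<in>P. card (Q T))" by (rule card_UN_le[OF finP])
  also have "\<dots> \<le> card P * 2^p" using sum_bounded_above[of P "\<lambda>T. card (Q T)" "2^p"] Q(2) by simp
  also have "\<dots> \<le> 4^p" unfolding p4 using P(2) by simp
  finally have "card (\<Union>T\<in>P. Q T) \<le> 4^p" .
  moreover have "trace_on \<alpha> U = 0 \<and> bounded_on \<alpha> (vec.span U) (4 * c / 2^p)" if TU: "T \<in> P" "U \<in> Q T" for T U
  proof
    have "trace_on \<alpha> U = trace_on re_part U + \<i> * trace_on im_part U"
      unfolding trace_on_def sum_distrib_left sum.distrib[symmetric] by (intro sum.cong refl re_part_plus_im_part)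
    then show "trace_on \<alpha> U = 0" using Q(3)[OF TU] by simp
    show "bounded_on \<alpha> (vec.span U) (4 * c / 2^p)"
      unfolding bounded_on_def
    proof (intro ballI)
      fix x y assume xy: "x \<in> vec.span U" "y \<in> vec.span U"
      then have "x \<in> vec.span T" "y \<in> vec.span T"
        using orthogonal_decompositionD(6)[OF Q(1)[OF TU(1)] TU(2)] by auto
      then have "cmod (re_part x y) \<le> 2 * c / 2^p * norm x * norm y"
        using P(3)[OF TU(1)] by (auto simp: bounded_on_def)
      moreover have "cmod (im_part x y) \<le> 2 * c / 2^p * norm x * norm y"
        using Q(3)[OF TU] xy by (auto simp: bounded_on_def)
      moreover have "cmod (\<alpha> x y) \<le> cmod (re_part x y) + cmod (im_part x y)"
        using norm_triangle_ineq[of "re_part x y" "\<i> * im_part x y"]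
        by (simp add: norm_mult flip: re_part_plus_im_part)
      moreover have "4 * c / 2^p * norm x * norm y = 2 * (2 * c / 2^p * norm x * norm y)" by simp
      ultimately show "cmod (\<alpha> x y) \<le> 4 * c / 2^p * norm x * norm y" by linarith
    qed
  qed
  ultimately show ?thesis
    using decomposition_refine[OF P(1) Q(1)] Q(3) by (intro exI[of _ "\<Union>T\<in>P. Q T"]) auto
qed

text \<open>A form of trace zero can be paved with norm ratio \<open>4 / 2\<^sup>p\<close> by at most \<open>2 \<cdot> 4\<^sup>p\<close> subspaces of trace
zero. That norm \<open>\<epsilon>\<close> costs only about \<open>\<epsilon>\<^sup>-\<^sup>2\<close> blocks is what makes the recursion lose no more than a constant per
level; discs in the plane of radius about \<open>\<epsilon>\<close> still fit in that number. At most \<open>4\<^sup>p\<close> blocks come from halving, and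
fewer than \<open>4\<^sup>p\<close> are the isotropic lines that were split off; these have dimension \<open>1\<close>, hence the maximum.\<close>

lemma paving:
  assumes S: "orthonormal S" and bd: "bounded_on \<alpha> (vec.span S) c" "c \<ge> 0" and tr: "trace_on \<alpha> S = 0"
  shows "\<exists>P. orthogonal_decomposition P S \<and> card P \<le> 2 * 4^p \<and>
    (\<forall>T\<in>P. card T \<le> max 1 (card S div 4^p) \<and> trace_on \<alpha> T = 0 \<and> bounded_on \<alpha> (vec.span T) (4 * c / 2^p))"
proof -
  note parts = trace_on_parts[OF tr]
  let ?s = "card S mod 4^p"
  obtain X R where XR: "X \<inter> R = {}" "orthonormal (X \<union> R)" "vec.span (X \<union> R) = vec.span S" "card X = ?s"
    "\<forall>x\<in>X. re_part x x = 0 \<and> im_part x x = 0" "trace_on re_part R = 0" "trace_on im_part R = 0"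
    using peel_isotropic[OF hermitian_re_part hermitian_im_part S parts, of ?s] by auto
  have fin: "finite X" "finite R" using orthonormalD(1)[OF XR(2)] by auto
  have oXR: "orthonormal X" "orthonormal R" using orthonormal_subset[OF XR(2)] by auto
  have "card (X \<union> R) = card S"
    using orthonormal_card[OF XR(2)] orthonormal_card[OF S] XR(3) by simp
  then have "card R + ?s = card S" using fin XR(1,4) by (simp add: card_Un_disjoint)
  moreover have "4^p * (card S div 4^p) + ?s = card S" by simp
  ultimately have cR: "card R = 4^p * (card S div 4^p)" by linarith
  have RS: "vec.span R \<subseteq> vec.span S" unfolding XR(3)[symmetric] by (rule vec.span_mono) simp
  obtain Q where Q: "orthogonal_decomposition Q R" "card Q \<le> 4^p"
    "\<forall>T\<in>Q. card T = card S div 4^p \<and> trace_on \<alpha> T = 0 \<and> bounded_on \<alpha> (vec.span T) (4 * c / 2^p)"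
    using paving_divisible[OF oXR(2) cR bounded_on_subset[OF bounded_re_part[OF bd(1)] RS]
        bounded_on_subset[OF bounded_im_part[OF bd(1)] RS] bd(2) XR(6,7)] by blast
  define P0 where "P0 = (\<lambda>x. {x}) ` X"
  have dX: "orthogonal_decomposition P0 X"
    using fin oXR by (auto simp: orthogonal_decomposition_def P0_def disjoint_def)
  let ?f = "\<lambda>U. if U = R then Q else P0"
  have "orthogonal_decomposition (\<Union>U\<in>{X, R}. ?f U) (X \<union> R)"
  proof (rule decomposition_refine[OF two_part_decomposition[OF XR(2,1)]])
    fix U assume "U \<in> {X, R}"
    then show "orthogonal_decomposition (?f U) U" using dX Q(1) by auto
  qed
  then have dec: "orthogonal_decomposition (\<Union>U\<in>{X, R}. ?f U) S"
    using XR(3) by (simp add: orthogonal_decomposition_def)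
  have sub: "(\<Union>U\<in>{X, R}. ?f U) \<subseteq> P0 \<union> Q" by auto
  have "card P0 \<le> 4^p"
  proof -
    have "card P0 \<le> ?s" using card_image_le[OF fin(1), of "\<lambda>x. {x}"] XR(4) by (simp add: P0_def)
    also have "\<dots> \<le> 4^p" by (simp add: less_imp_le)
    finally show ?thesis .
  qed
  then have "card (P0 \<union> Q) \<le> 2 * 4^p" using Q(2) card_Un_le[of P0 Q] by linarith
  then have "card (\<Union>U\<in>{X, R}. ?f U) \<le> 2 * 4^p"
    using card_mono[OF _ sub] orthogonal_decompositionD(1)[OF dX] orthogonal_decompositionD(1)[OF Q(1)] by auto
  moreover have "card T \<le> max 1 (card S div 4^p) \<and> trace_on \<alpha> T = 0 \<and> bounded_on \<alpha> (vec.span T) (4 * c / 2^p)"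
    if T: "T \<in> P0 \<union> Q" for T
  proof (cases "T \<in> Q")
    case False
    then obtain x where x: "x \<in> X" "T = {x}" using T by (auto simp: P0_def)
    have "\<alpha> x x = 0" using XR(5) x re_part_plus_im_part[of x x] by simp
    moreover have "orthonormal T" using orthonormal_subset[OF oXR(1)] x by simp
    ultimately show ?thesis
      using x bd(2) by (auto simp: trace_on_def intro!: bounded_on_diagonal)
  qed (use Q in auto)
  ultimately show ?thesis using dec sub by (intro exI[of _ "\<Union>U\<in>{X, R}. ?f U"]) blast
qed

end

section \<open>Bounded matrices with entries indexed by vectors\<close>

abbreviation l2norm :: "'a set \<Rightarrow> ('a \<Rightarrow> complex) \<Rightarrow> real" where
  "l2norm S x \<equiv> L2_set (\<lambda>v. cmod (x v)) S"

text \<open>The operator norm of the matrix \<open>g\<close> is at most \<open>M\<close>, expressed through its sesquilinear form.\<close>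

definition matrix_bounded :: "'a set \<Rightarrow> 'b set \<Rightarrow> ('a \<Rightarrow> 'b \<Rightarrow> complex) \<Rightarrow> real \<Rightarrow> bool" where
  "matrix_bounded S T g M \<longleftrightarrow>
     (\<forall>x y. cmod (\<Sum>v\<in>S. \<Sum>w\<in>T. x v * cnj (y w) * g v w) \<le> M * l2norm S x * l2norm T y)"

lemma matrix_bounded_cong:
  assumes "\<And>v w. v \<in> S \<Longrightarrow> w \<in> T \<Longrightarrow> g v w = h v w"
  shows "matrix_bounded S T g M \<longleftrightarrow> matrix_bounded S T h M"
  unfolding matrix_bounded_def using assms by (simp cong: sum.cong)

lemma matrix_bounded_mono: "matrix_bounded S T g M \<Longrightarrow> M \<le> M' \<Longrightarrow> matrix_bounded S T g M'"
  unfolding matrix_bounded_def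
  by (meson L2_set_nonneg mult_right_mono order_trans)

lemma matrix_bounded_scale:
  assumes "matrix_bounded S T g M"
  shows "matrix_bounded S T (\<lambda>v w. k * g v w) (cmod k * M)"
  unfolding matrix_bounded_def
proof (intro allI)
  fix x y
  have "(\<Sum>v\<in>S. \<Sum>w\<in>T. x v * cnj (y w) * (k * g v w)) = k * (\<Sum>v\<in>S. \<Sum>w\<in>T. x v * cnj (y w) * g v w)"
    by (simp add: sum_distrib_left mult_ac)
  moreover have "cmod (\<Sum>v\<in>S. \<Sum>w\<in>T. x v * cnj (y w) * g v w) \<le> M * l2norm S x * l2norm T y"
    using assms by (auto simp: matrix_bounded_def)
  ultimately show "cmod (\<Sum>v\<in>S. \<Sum>w\<in>T. x v * cnj (y w) * (k * g v w)) \<le> cmod k * M * l2norm S x * l2norm T y"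
    by (simp add: norm_mult mult_left_mono mult.assoc)
qed

lemma matrix_bounded_exists:
  assumes "finite S" "finite T"
  shows "\<exists>M\<ge>0. matrix_bounded S T g M"
proof (intro exI conjI)
  let ?M = "\<Sum>v\<in>S. \<Sum>w\<in>T. cmod (g v w)"
  show "?M \<ge> 0" by (intro sum_nonneg) auto
  show "matrix_bounded S T g ?M"
    unfolding matrix_bounded_def
  proof (intro allI)
    fix x y
    have "cmod (\<Sum>v\<in>S. \<Sum>w\<in>T. x v * cnj (y w) * g v w) \<le> (\<Sum>v\<in>S. \<Sum>w\<in>T. cmod (x v) * cmod (y w) * cmod (g v w))"
      by (intro order_trans[OF norm_sum] sum_mono) (auto simp: norm_mult)
    also have "\<dots> \<le> (\<Sum>v\<in>S. \<Sum>w\<in>T. l2norm S x * l2norm T y * cmod (g v w))"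
      using assms by (intro sum_mono mult_right_mono mult_mono member_le_L2_set) auto
    also have "\<dots> = ?M * l2norm S x * l2norm T y"
      by (simp add: sum_distrib_left sum_distrib_right mult_ac)
    finally show "cmod (\<Sum>v\<in>S. \<Sum>w\<in>T. x v * cnj (y w) * g v w) \<le> ?M * l2norm S x * l2norm T y" .
  qed
qed

lemma (in sesquilinear) matrix_bounded_form:
  assumes bd: "bounded_on \<alpha> E c" and S: "orthonormal S" "vec.span S \<subseteq> E" and T: "orthonormal T" "vec.span T \<subseteq> E"
  shows "matrix_bounded S T \<alpha> c"
  unfolding matrix_bounded_def
proof (intro allI)
  fix x y
  have "(\<Sum>v\<in>S. x v *s v) \<in> E" "(\<Sum>w\<in>T. y w *s w) \<in> E"
    using S(2) T(2) by (meson subsetD vec.span_base vec.span_scale vec.span_sum)+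
  then have "cmod (\<alpha> (\<Sum>v\<in>S. x v *s v) (\<Sum>w\<in>T. y w *s w)) \<le> c * l2norm S x * l2norm T y"
    using bd unfolding bounded_on_def
    unfolding norm_sum_orthonormal[OF S(1), of x, symmetric] norm_sum_orthonormal[OF T(1), of y, symmetric]
    by blast
  then show "cmod (\<Sum>v\<in>S. \<Sum>w\<in>T. x v * cnj (y w) * \<alpha> v w) \<le> c * l2norm S x * l2norm T y"
    by (simp add: sum_sum)
qed

lemma l2norm_scale_le:
  assumes "\<And>v. v \<in> S \<Longrightarrow> cmod (x' v) \<le> r * cmod (x v)" "r \<ge> 0"
  shows "l2norm S x' \<le> r * l2norm S x"
  using L2_set_mono[of S "\<lambda>v. cmod (x' v)" "\<lambda>v. r * cmod (x v)"] assms
  by (simp add: L2_set_right_distrib)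

text \<open>The solution of the Sylvester equation \<open>X b - a X = m\<close> for diagonal matrices \<open>a\<close> and \<open>b\<close>, when the
spectrum of \<open>b\<close> lies in the disc of radius \<open>\<rho>\<close> about \<open>z\<close> and that of \<open>a\<close> outside of the disc of radius \<open>2 \<rho>\<close>. From
\<open>(a - z) X = X (b - z) - m\<close> a bound \<open>M\<close> for \<open>X\<close> improves to \<open>M / 2 + c / (2 \<rho>)\<close>; the fixed point of this
improvement is \<open>c / \<rho>\<close>.\<close>

lemma matrix_bounded_separated:
  fixes c \<rho> :: real
  assumes fin: "finite S" "finite T" and \<rho>: "\<rho> > 0"
    and far: "\<And>v. v \<in> S \<Longrightarrow> cmod (a v - z) \<ge> 2 * \<rho>"
    and near: "\<And>w. w \<in> T \<Longrightarrow> cmod (b w - z) \<le> \<rho>"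
    and m: "matrix_bounded S T m c" "c \<ge> 0"
  shows "matrix_bounded S T (\<lambda>v w. m v w / (b w - a v)) (c / \<rho>)"
proof -
  define g where "g v w = m v w / (b w - a v)" for v w
  have az: "a v - z \<noteq> 0" if "v \<in> S" for v using far[OF that] \<rho> by auto
  have key: "g v w = ((b w - z) * g v w - m v w) / (a v - z)" if "v \<in> S" "w \<in> T" for v w
  proof -
    have "b w - a v \<noteq> 0" using far[OF that(1)] near[OF that(2)] \<rho> by auto
    then have "(b w - a v) * g v w = m v w" by (simp add: g_def)
    then have "(b w - z) * g v w - m v w = (a v - z) * g v w" by (simp add: algebra_simps)
    then show ?thesis using az[OF that(1)] by simp
  qed
  have step: "matrix_bounded S T g (M / 2 + c / (2 * \<rho>))" if M: "matrix_bounded S T g M" "M \<ge> 0" for M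
    unfolding matrix_bounded_def
  proof (intro allI)
    fix x y
    define x' where "x' v = x v / (a v - z)" for v
    define y' where "y' w = cnj (b w - z) * y w" for w
    have "(\<Sum>v\<in>S. \<Sum>w\<in>T. x v * cnj (y w) * g v w)
        = (\<Sum>v\<in>S. \<Sum>w\<in>T. x' v * cnj (y' w) * g v w - x' v * cnj (y w) * m v w)"
    proof (intro sum.cong refl)
      fix v w assume vw: "v \<in> S" "w \<in> T"
      have "x v * cnj (y w) * g v w = x v * cnj (y w) * (((b w - z) * g v w - m v w) / (a v - z))"
        using key[OF vw] by simp
      then show "x v * cnj (y w) * g v w = x' v * cnj (y' w) * g v w - x' v * cnj (y w) * m v w"
        by (simp add: x'_def y'_def right_diff_distrib diff_divide_distrib mult_ac)
    qed
    also have "\<dots> = (\<Sum>v\<in>S. \<Sum>w\<in>T. x' v * cnj (y' w) * g v w) - (\<Sum>v\<in>S. \<Sum>w\<in>T. x' v * cnj (y w) * m v w)"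
      by (simp add: sum_subtractf)
    finally have "cmod (\<Sum>v\<in>S. \<Sum>w\<in>T. x v * cnj (y w) * g v w) \<le>
        M * l2norm S x' * l2norm T y' + c * l2norm S x' * l2norm T y"
      using M(1) m(1) by (simp only: matrix_bounded_def) (intro order_trans[OF norm_triangle_ineq4] add_mono; blast)
    also have "\<dots> \<le> M * (1 / (2 * \<rho>) * l2norm S x) * (\<rho> * l2norm T y) + c * (1 / (2 * \<rho>) * l2norm S x) * l2norm T y"
    proof -
      have "cmod (x' v) \<le> 1 / (2 * \<rho>) * cmod (x v)" if "v \<in> S" for v
      proof -
        have "1 / cmod (a v - z) \<le> 1 / (2 * \<rho>)" using far[OF that] az[OF that] \<rho> by (intro divide_left_mono mult_pos_pos) auto
        then have "1 / cmod (a v - z) * cmod (x v) \<le> 1 / (2 * \<rho>) * cmod (x v)" by (intro mult_right_mono) auto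
        then show ?thesis by (simp add: x'_def norm_divide)
      qed
      then have 1: "l2norm S x' \<le> 1 / (2 * \<rho>) * l2norm S x" using \<rho> by (intro l2norm_scale_le) auto
      have 2: "l2norm T y' \<le> \<rho> * l2norm T y"
        using near \<rho> by (intro l2norm_scale_le)
          (simp_all only: y'_def norm_mult complex_mod_cnj mult_right_mono norm_ge_zero less_imp_le)
      have nn: "0 \<le> 1 / (2 * \<rho>) * l2norm S x" using \<rho> by simp
      show ?thesis
        by (intro add_mono mult_mono order_refl 1 2 mult_nonneg_nonneg nn M(2) m(2) L2_set_nonneg)
    qed
    also have "\<dots> = (M / 2 + c / (2 * \<rho>)) * l2norm S x * l2norm T y"
    proof -
      have "M * (1 / (2 * \<rho>) * l2norm S x) * (\<rho> * l2norm T y) = M / 2 * l2norm S x * l2norm T y"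
        using \<rho> by simp
      moreover have "c * (1 / (2 * \<rho>) * l2norm S x) * l2norm T y = c / (2 * \<rho>) * l2norm S x * l2norm T y"
        by simp
      ultimately show ?thesis by (simp only: distrib_right)
    qed
    finally show "cmod (\<Sum>v\<in>S. \<Sum>w\<in>T. x v * cnj (y w) * g v w) \<le> (M / 2 + c / (2 * \<rho>)) * l2norm S x * l2norm T y" .
  qed
  obtain M where M: "M \<ge> 0" "matrix_bounded S T g M" using matrix_bounded_exists[OF fin] by blast
  have iter: "matrix_bounded S T g (c / \<rho> + M * (1/2)^n)" for n
  proof (induction n)
    case 0
    show ?case by (rule matrix_bounded_mono[OF M(2)]) (use m(2) \<rho> in simp)
  next
    case (Suc n)
    have "c / \<rho> + M * (1/2)^n \<ge> 0" using m(2) M(1) \<rho> by simp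
    from step[OF Suc this] show ?case by (rule matrix_bounded_mono) (use \<rho> in \<open>simp add: field_simps\<close>)
  qed
  have "matrix_bounded S T g (c / \<rho>)"
    unfolding matrix_bounded_def
  proof (intro allI)
    fix x y
    have "(\<lambda>n. (c / \<rho> + M * (1/2)^n) * l2norm S x * l2norm T y) \<longlonglongrightarrow> (c / \<rho> + M * 0) * l2norm S x * l2norm T y"
      by (intro tendsto_intros LIMSEQ_realpow_zero) auto
    then show "cmod (\<Sum>v\<in>S. \<Sum>w\<in>T. x v * cnj (y w) * g v w) \<le> c / \<rho> * l2norm S x * l2norm T y"
      using iter by (intro LIMSEQ_le_const[where X = "\<lambda>n. (c / \<rho> + M * (1/2)^n) * l2norm S x * l2norm T y"])
        (auto simp: matrix_bounded_def)
  qed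
  then show ?thesis by (simp only: g_def[abs_def])
qed

text \<open>Diagonal blocks are mutually orthogonal and contribute only their maximum; for the other blocks the
Cauchy-Schwarz inequality over the block index costs a factor \<open>card P\<close>.\<close>

lemma matrix_bounded_blocks:
  fixes D K :: real
  assumes P: "finite P" "\<And>X. X \<in> P \<Longrightarrow> finite (f X)"
    "\<And>X Y. X \<in> P \<Longrightarrow> Y \<in> P \<Longrightarrow> X \<noteq> Y \<Longrightarrow> f X \<inter> f Y = {}"
    and diag: "\<And>X. X \<in> P \<Longrightarrow> matrix_bounded (f X) (f X) g D"
    and off: "\<And>X Y. X \<in> P \<Longrightarrow> Y \<in> P \<Longrightarrow> X \<noteq> Y \<Longrightarrow> matrix_bounded (f X) (f Y) g K"
    and "D \<ge> 0" "K \<ge> 0"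
  shows "matrix_bounded (\<Union>X\<in>P. f X) (\<Union>X\<in>P. f X) g (D + card P * K)"
  unfolding matrix_bounded_def
proof (intro allI)
  fix x y
  let ?U = "\<Union>X\<in>P. f X"
  let ?a = "\<lambda>X. l2norm (f X) x" and ?b = "\<lambda>X. l2norm (f X) y"
  have split: "sum h ?U = (\<Sum>X\<in>P. sum h (f X))" for h :: "_ \<Rightarrow> 'c::comm_monoid_add"
    using P by (intro sum.UNION_disjoint) auto
  have l2: "l2norm ?U z = L2_set (\<lambda>X. l2norm (f X) z) P" for z
    using split[of "\<lambda>v. (cmod (z v))\<^sup>2"] by (simp add: L2_set_def sum_nonneg)
  have l1: "(\<Sum>X\<in>P. l2norm (f X) z) \<le> sqrt (card P) * l2norm ?U z" for z
    using L2_set_mult_ineq[of "\<lambda>X. l2norm (f X) z" "\<lambda>_. 1" P]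
    unfolding l2 by (simp add: L2_set_def[of "\<lambda>_. 1"] mult.commute)
  have "(\<Sum>v\<in>?U. \<Sum>w\<in>?U. x v * cnj (y w) * g v w)
      = (\<Sum>X\<in>P. \<Sum>v\<in>f X. \<Sum>Y\<in>P. \<Sum>w\<in>f Y. x v * cnj (y w) * g v w)"
    by (simp only: split)
  also have "\<dots> = (\<Sum>X\<in>P. \<Sum>Y\<in>P. \<Sum>v\<in>f X. \<Sum>w\<in>f Y. x v * cnj (y w) * g v w)"
    by (intro sum.cong refl sum.swap)
  finally have "cmod (\<Sum>v\<in>?U. \<Sum>w\<in>?U. x v * cnj (y w) * g v w)
      \<le> (\<Sum>X\<in>P. \<Sum>Y\<in>P. cmod (\<Sum>v\<in>f X. \<Sum>w\<in>f Y. x v * cnj (y w) * g v w))"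
    by (simp only:) (intro order_trans[OF norm_sum] sum_mono order_refl)
  also have "\<dots> \<le> (\<Sum>X\<in>P. \<Sum>Y\<in>P. (if X = Y then D * ?a X * ?b Y else 0) + K * ?a X * ?b Y)"
  proof (intro sum_mono)
    fix X Y assume XY: "X \<in> P" "Y \<in> P"
    show "cmod (\<Sum>v\<in>f X. \<Sum>w\<in>f Y. x v * cnj (y w) * g v w) \<le> (if X = Y then D * ?a X * ?b Y else 0) + K * ?a X * ?b Y"
    proof (cases "X = Y")
      case True
      have "cmod (\<Sum>v\<in>f X. \<Sum>w\<in>f X. x v * cnj (y w) * g v w) \<le> D * ?a X * ?b X"
        using diag[OF XY(1)] by (auto simp: matrix_bounded_def)
      moreover have "0 \<le> K * ?a X * ?b X" using \<open>K \<ge> 0\<close> by simp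
      ultimately show ?thesis using True by simp
    next
      case False
      then show ?thesis using off[OF XY False] by (simp add: matrix_bounded_def)
    qed
  qed
  also have "\<dots> = D * (\<Sum>X\<in>P. \<bar>?a X\<bar> * \<bar>?b X\<bar>) + K * ((\<Sum>X\<in>P. ?a X) * (\<Sum>X\<in>P. ?b X))"
  proof -
    have "(\<Sum>X\<in>P. \<Sum>Y\<in>P. K * ?a X * ?b Y) = K * ((\<Sum>X\<in>P. ?a X) * (\<Sum>Y\<in>P. ?b Y))"
      by (simp only: sum_product) (simp only: sum_distrib_left mult.assoc)
    moreover have "(\<Sum>X\<in>P. D * ?a X * ?b X) = D * (\<Sum>X\<in>P. \<bar>?a X\<bar> * \<bar>?b X\<bar>)"
      unfolding sum_distrib_left by (simp add: mult.assoc)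
    ultimately show ?thesis using P(1) by (simp add: sum.distrib)
  qed
  also have "\<dots> \<le> D * (l2norm ?U x * l2norm ?U y) + K * ((sqrt (card P) * l2norm ?U x) * (sqrt (card P) * l2norm ?U y))"
    using L2_set_mult_ineq[of ?a ?b P] l1[of x] l1[of y] \<open>D \<ge> 0\<close> \<open>K \<ge> 0\<close>
    by (intro add_mono mult_left_mono mult_mono) (auto simp: l2 intro!: sum_nonneg)
  also have "\<dots> = (D + card P * K) * l2norm ?U x * l2norm ?U y"
    using real_sqrt_mult_self[of "card P"] by (simp add: algebra_simps)
  finally show "cmod (\<Sum>v\<in>?U. \<Sum>w\<in>?U. x v * cnj (y w) * g v w) \<le> (D + card P * K) * l2norm ?U x * l2norm ?U y" .
qed

section \<open>Recursive choice of basis and eigenvalues\<close>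

text \<open>The commutator in terms of forms, with a normal \<open>B\<close>: \<open>b\<close> lists the eigenvalues of \<open>B\<close> in the
basis \<open>T\<close>, and the entries of \<open>C\<close> are forced to be \<open>\<alpha> v w / (b w - b v)\<close> (which is \<open>0\<close> on the diagonal, as division
by \<open>0\<close> yields \<open>0\<close>).

Pave with \<open>2 \<cdot> 4\<^sup>p\<close> blocks and solve the problem in each block by induction, with eigenvalues in the
unit disc. Shrink these discs to radius \<open>s = 1 / (10 \<cdot> 2\<^sup>p)\<close> and place them inside the unit disc with centres
at least \<open>3 s\<close> apart. In the diagonal blocks of \<open>C\<close> the factor \<open>1 / s\<close> from shrinking is almost
compensated by the factor \<open>4 / 2\<^sup>p\<close> from paving, leaving the absolute constant \<open>40\<close> while the dimension drops by \<open>4\<^sup>p\<close>.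
The remaining blocks are bounded by \<open>c / s\<close> each because of the separation, in total by
\<open>2 \<cdot> 4\<^sup>p \<cdot> c / s = 20 c \<cdot> 8\<^sup>p\<close>. The bound in the statement solves the resulting recursion
\<open>M\<^sub>q\<^sub>+\<^sub>1 = 40 M\<^sub>q + 20 c \<cdot> 8\<^sup>p\<close> with room to spare.\<close>

lemma (in sesquilinear) commutator_solution:
  assumes "orthonormal S" "card S \<le> (4^p)^q" "bounded_on \<alpha> (vec.span S) c" "c \<ge> 0" "trace_on \<alpha> S = 0"
  shows "\<exists>T b. orthonormal T \<and> vec.span T = vec.span S \<and> (\<forall>v\<in>T. \<alpha> v v = 0) \<and> inj_on b T \<and>
    (\<forall>v\<in>T. cmod (b v) \<le> 1) \<and> matrix_bounded T T (\<lambda>v w. \<alpha> v w / (b w - b v)) (c * (40^q - 1) * 8^p)"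
  using assms
proof (induction q arbitrary: S c)
  case 0
  have fin: "finite S" using 0 by (simp add: orthonormal_def)
  have one: "v = w" if "v \<in> S" "w \<in> S" for v w
    using 0(2) fin that by (auto simp: card_le_Suc0_iff_eq)
  have "\<alpha> v v = 0" if "v \<in> S" for v
  proof -
    have "S = {v}" using one that by blast
    then show ?thesis using 0(5) by (simp add: trace_on_def)
  qed
  then show ?case
    using 0(1) one by (intro exI[of _ S] exI[of _ "\<lambda>_. 0"]) (auto simp: inj_on_def matrix_bounded_def)
next
  case (Suc q)
  obtain P where P: "orthogonal_decomposition P S" "card P \<le> 2 * 4^p"
    "\<And>X. X \<in> P \<Longrightarrow> card X \<le> max 1 (card S div 4^p) \<and> trace_on \<alpha> X = 0 \<and> bounded_on \<alpha> (vec.span X) (4 * c / 2^p)"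
    using paving[OF Suc.prems(1,3,4,5), of p] by blast
  note PD = orthogonal_decompositionD[OF P(1)]
  define M where "M = 4 * c / 2^p * (40^q - 1) * 8^p"
  have M0: "M \<ge> 0" using Suc.prems(4) by (simp add: M_def)
  have "card S div 4^p \<le> (4^p)^q"
    using div_le_mono[OF Suc.prems(2), of "4^p"] by simp
  then have small: "card X \<le> (4^p)^q" if "X \<in> P" for X
    using P(3)[OF that] by (meson le_trans max.boundedI one_le_numeral one_le_power)
  define solves where "solves X T b \<longleftrightarrow> orthonormal T \<and> vec.span T = vec.span X \<and> (\<forall>v\<in>T. \<alpha> v v = 0) \<and>
    inj_on b T \<and> (\<forall>v\<in>T. cmod (b v) \<le> 1) \<and> matrix_bounded T T (\<lambda>v w. \<alpha> v w / (b w - b v)) M" for X T b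
  have "\<exists>T b. solves X T b" if "X \<in> P" for X
    unfolding solves_def M_def using P(3)[OF that] PD(5)[OF that] Suc.prems(4) small[OF that]
    by (intro Suc.IH) auto
  then obtain f bb where "\<And>X. X \<in> P \<Longrightarrow> solves X (f X) (bb X)" by metis
  then have fb: "\<And>X. X \<in> P \<Longrightarrow> orthonormal (f X)" "\<And>X. X \<in> P \<Longrightarrow> vec.span (f X) = vec.span X"
    "\<And>X v. X \<in> P \<Longrightarrow> v \<in> f X \<Longrightarrow> \<alpha> v v = 0" "\<And>X. X \<in> P \<Longrightarrow> inj_on (bb X) (f X)"
    "\<And>X v. X \<in> P \<Longrightarrow> v \<in> f X \<Longrightarrow> cmod (bb X v) \<le> 1"
    "\<And>X. X \<in> P \<Longrightarrow> matrix_bounded (f X) (f X) (\<lambda>v w. \<alpha> v w / (bb X w - bb X v)) M"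
    unfolding solves_def by blast+
  have U: "orthonormal (\<Union>X\<in>P. f X)" "vec.span (\<Union>X\<in>P. f X) = vec.span S"
    and disj: "\<And>X Y. X \<in> P \<Longrightarrow> Y \<in> P \<Longrightarrow> X \<noteq> Y \<Longrightarrow> f X \<inter> f Y = {}"
    using decomposition_change_bases[OF P(1), of f] fb(1,2) by blast+
  obtain h where h: "bij_betw h P {0..<card P}" using ex_bij_betw_finite_nat[OF PD(1)] by blast
  define s :: real where "s = 1 / (10 * 2^p)"
  have s: "s > 0" "s \<le> 1 / 10" by (auto simp: s_def field_simps)
  \<comment> \<open>Distinct points of \<open>3 s\<close> times the integer grid of size \<open>2\<^sup>p\<close> by \<open>2\<^sup>p\<^sup>+\<^sup>1\<close>, which has room for \<open>2 \<cdot> 4\<^sup>p\<close> centres.\<close>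
  define z where "z X = complex_of_real (3 * s) * Complex (real (h X div 2^(p+1))) (real (h X mod 2^(p+1)))" for X
  have z_far: "cmod (z X - z Y) \<ge> 3 * s" if "X \<in> P" "Y \<in> P" "X \<noteq> Y" for X Y
  proof -
    let ?i = "h X div 2^(p+1)" and ?j = "h X mod 2^(p+1)" and ?k = "h Y div 2^(p+1)" and ?l = "h Y mod 2^(p+1)"
    have "h X \<noteq> h Y" using h that by (auto simp: bij_betw_def inj_on_def)
    then have "?i \<noteq> ?k \<or> ?j \<noteq> ?l" by (metis div_mult_mod_eq)
    then have "\<bar>real ?i - real ?k\<bar> \<ge> 1 \<or> \<bar>real ?j - real ?l\<bar> \<ge> 1" by linarith
    then have "cmod (Complex (real ?i) (real ?j) - Complex (real ?k) (real ?l)) \<ge> 1"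
      using abs_Re_le_cmod[of "Complex (real ?i) (real ?j) - Complex (real ?k) (real ?l)"]
        abs_Im_le_cmod[of "Complex (real ?i) (real ?j) - Complex (real ?k) (real ?l)"] by fastforce
    then have "3 * s * 1 \<le> 3 * s * cmod (Complex (real ?i) (real ?j) - Complex (real ?k) (real ?l))"
      using s by (intro mult_left_mono) auto
    also have "\<dots> = cmod (z X - z Y)"
      unfolding z_def right_diff_distrib[symmetric] norm_mult using s by simp
    finally show ?thesis by simp
  qed
  have z_small: "cmod (z X) \<le> 1 - s" if "X \<in> P" for X
  proof -
    have "h X < card P" using h that by (auto simp: bij_betw_def)
    moreover have "(4::nat)^p = 2^p * 2^p" by (simp flip: power_mult_distrib)
    then have "(2::nat) * 4^p = 2^p * 2^(p+1)" by simp
    ultimately have "h X < 2^p * 2^(p+1)" using P(2) by linarith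
    then have "h X div 2^(p+1) < 2^p" by (simp add: less_mult_imp_div_less)
    moreover have "h X mod 2^(p+1) < 2^(p+1)" by simp
    ultimately have "h X div 2^(p+1) + 1 + (h X mod 2^(p+1)) + 1 \<le> 2^p + 2^(p+1)" by linarith
    then have "h X div 2^(p+1) + (h X mod 2^(p+1)) + 2 \<le> 3 * 2^p" by simp
    then have "real (h X div 2^(p+1) + (h X mod 2^(p+1)) + 2) \<le> real (3 * 2^p)" by (simp only: of_nat_le_iff)
    then have "real (h X div 2^(p+1)) + real (h X mod 2^(p+1)) \<le> 3 * 2^p" by simp
    then have "cmod (Complex (real (h X div 2^(p+1))) (real (h X mod 2^(p+1)))) \<le> 3 * 2^p"
      using cmod_le[of "Complex (real (h X div 2^(p+1))) (real (h X mod 2^(p+1)))"] by simp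
    then have "cmod (z X) \<le> 3 * s * (3 * 2^p)"
      unfolding z_def norm_mult using s by (intro mult_mono) auto
    also have "\<dots> = 9 / 10" by (simp add: s_def)
    finally show ?thesis using s by simp
  qed
  define blk where "blk v = (SOME X. X \<in> P \<and> v \<in> f X)" for v
  have blk: "blk v = X" if "X \<in> P" "v \<in> f X" for v X
  proof -
    have "blk v \<in> P \<and> v \<in> f (blk v)" unfolding blk_def by (rule someI[of _ X]) (use that in auto)
    then show ?thesis using disj[of "blk v" X] that by blast
  qed
  define b where "b v = z (blk v) + of_real s * bb (blk v) v" for v
  have b_eq: "b v = z X + of_real s * bb X v" if "X \<in> P" "v \<in> f X" for v X
    using blk[OF that] by (simp add: b_def)
  have near: "cmod (b v - z X) \<le> s" if "X \<in> P" "v \<in> f X" for v X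
    using mult_left_mono[OF fb(5)[OF that], of s] s by (simp add: b_eq[OF that] norm_mult)
  have far: "cmod (b v - z Y) \<ge> 2 * s" if "X \<in> P" "Y \<in> P" "X \<noteq> Y" "v \<in> f X" for v X Y
    using z_far[OF that(1-3)] near[OF that(1,4)] norm_triangle_ineq[of "b v - z Y" "z X - b v"]
    by (simp add: norm_minus_commute)
  have "inj_on b (\<Union>X\<in>P. f X)"
  proof (rule inj_onI)
    fix v w assume "v \<in> (\<Union>X\<in>P. f X)" "w \<in> (\<Union>X\<in>P. f X)" and eq: "b v = b w"
    then obtain X Y where XY: "X \<in> P" "v \<in> f X" "Y \<in> P" "w \<in> f Y" by blast
    have "X = Y"
    proof (rule ccontr)
      assume "X \<noteq> Y"
      then show False using far[OF XY(1,3) _ XY(2)] near[OF XY(3,4)] eq s by auto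
    qed
    then have "bb X v = bb X w" using eq b_eq XY s by auto
    then show "v = w" using fb(4)[OF XY(1)] XY \<open>X = Y\<close> by (auto dest: inj_onD)
  qed
  moreover have "cmod (b v) \<le> 1" if "X \<in> P" "v \<in> f X" for v X
    using near[OF that] z_small[OF that(1)] norm_triangle_ineq[of "b v - z X" "z X"] by simp
  moreover have "matrix_bounded (\<Union>X\<in>P. f X) (\<Union>X\<in>P. f X) (\<lambda>v w. \<alpha> v w / (b w - b v)) (c * (40^Suc q - 1) * 8^p)"
  proof (rule matrix_bounded_mono)
    show "matrix_bounded (\<Union>X\<in>P. f X) (\<Union>X\<in>P. f X) (\<lambda>v w. \<alpha> v w / (b w - b v)) (M / s + card P * (c / s))"
    proof (rule matrix_bounded_blocks[OF PD(1) _ disj])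
      show "finite (f X)" if "X \<in> P" for X using fb(1)[OF that] by (rule orthonormalD)
      show "M / s \<ge> 0" "c / s \<ge> 0" using M0 s Suc.prems(4) by auto
      show "matrix_bounded (f X) (f X) (\<lambda>v w. \<alpha> v w / (b w - b v)) (M / s)" if X: "X \<in> P" for X
      proof -
        have "cmod (of_real (1 / s)) * M = M / s" using s by (simp add: norm_divide)
        then have "matrix_bounded (f X) (f X) (\<lambda>v w. of_real (1 / s) * (\<alpha> v w / (bb X w - bb X v))) (M / s)"
          using matrix_bounded_scale[OF fb(6)[OF X], of "of_real (1 / s)"] by (simp only:)
        moreover have "of_real (1 / s) * (\<alpha> v w / (bb X w - bb X v)) = \<alpha> v w / (b w - b v)"
          if "v \<in> f X" "w \<in> f X" for v w
        proof -
          have "b w - b v = of_real s * (bb X w - bb X v)"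
            using b_eq[OF X] that by (simp add: algebra_simps)
          then show ?thesis by simp
        qed
        ultimately show ?thesis by (subst matrix_bounded_cong[symmetric]) auto
      qed
      show "matrix_bounded (f X) (f Y) (\<lambda>v w. \<alpha> v w / (b w - b v)) (c / s)"
        if XY: "X \<in> P" "Y \<in> P" "X \<noteq> Y" for X Y
      proof (rule matrix_bounded_separated[where z = "z Y"])
        show "finite (f X)" "finite (f Y)" using fb(1) XY orthonormalD(1) by blast+
        show "2 * s \<le> cmod (b v - z Y)" if "v \<in> f X" for v by (rule far[OF XY that])
        show "cmod (b w - z Y) \<le> s" if "w \<in> f Y" for w by (rule near[OF XY(2) that])
        show "matrix_bounded (f X) (f Y) \<alpha> c"
          using fb(2) PD(6) XY by (intro matrix_bounded_form[OF Suc.prems(3)] fb(1)) auto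
      qed (use s Suc.prems(4) in auto)
    qed
    have "(8::real)^p = 4^p * 2^p" by (simp flip: power_mult_distrib)
    have "real (card P) \<le> 2 * 4^p" using P(2) by (metis of_nat_le_iff of_nat_mult of_nat_numeral of_nat_power)
    then have "card P * (c / s) \<le> 2 * 4^p * (c / s)" using Suc.prems(4) s by (intro mult_right_mono) auto
    also have "\<dots> = 20 * c * 8^p" unfolding s_def \<open>8^p = _\<close> by simp
    finally have "card P * (c / s) \<le> 20 * (c * 8^p)" by (simp add: mult.assoc)
    moreover have "M / s = 40 * (40^q - 1) * (c * 8^p)" by (simp add: M_def s_def)
    ultimately have "M / s + card P * (c / s) \<le> 40 * (40^q - 1) * (c * 8^p) + 20 * (c * 8^p)"
      by linarith
    also have "\<dots> = (40^Suc q - 20) * (c * 8^p)" by (simp add: algebra_simps)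
    also have "\<dots> \<le> (40^Suc q - 1) * (c * 8^p)" using Suc.prems(4) by (intro mult_right_mono) auto
    finally show "M / s + card P * (c / s) \<le> c * (40^Suc q - 1) * 8^p" by (simp add: mult_ac)
  qed
  ultimately show ?case
    using U fb(3) by (intro exI[of _ "\<Union>X\<in>P. f X"] exI[of _ b]) auto
qed

section \<open>From forms to matrices, and the choice of parameters\<close>

definition matrix_form :: "complex^'n^'n \<Rightarrow> complex^'n \<Rightarrow> complex^'n \<Rightarrow> complex" where
  "matrix_form A x y = cdot (A *v x) y"

lemma sesquilinear_matrix_form: "sesquilinear (matrix_form A)"
  by unfold_locales
     (auto simp: matrix_form_def cdot.expand matrix_vector_right_distrib vec.scale)

lemma bounded_linear_matrix:
  fixes A :: "complex^'n^'n"
  shows "bounded_linear ((*v) A)"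
proof -
  have "linear ((*v) A)"
    by (rule linearI) (auto simp: matrix_vector_right_distrib scaleR_eq_scale vec.scale)
  then show ?thesis by (rule linear_conv_bounded_linear[THEN iffD1])
qed

lemma norm_le_op_norm: "norm (A *v x) \<le> op_norm A * norm (x :: complex^'n)"
  unfolding op_norm_def by (rule onorm[OF bounded_linear_matrix])

lemma op_norm_nonneg:
  fixes A :: "complex^'n^'n"
  shows "op_norm A \<ge> 0"
  unfolding op_norm_def by (rule onorm_pos_le[OF bounded_linear_matrix])

lemma bounded_on_matrix_form: "bounded_on (matrix_form A) E (op_norm A)"
  unfolding bounded_on_def matrix_form_def
proof (intro ballI)
  fix x y
  have "cmod (cdot (A *v x) y) \<le> norm (A *v x) * norm y" by (rule cdot_Cauchy_Schwarz)
  also have "\<dots> \<le> op_norm A * norm x * norm y" by (intro mult_right_mono norm_le_op_norm) auto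
  finally show "cmod (cdot (A *v x) y) \<le> op_norm A * norm x * norm y" .
qed

lemma cdot_axis: "cdot x (axis i 1) = x $ i"
proof -
  have "cdot x (axis i 1) = (\<Sum>k\<in>UNIV. if k = i then x $ k else 0)"
    unfolding cdot_def by (intro sum.cong) (auto simp: axis_def)
  then show ?thesis by simp
qed

lemma cart_basis_eq: "(cart_basis :: (complex^'n) set) = range (\<lambda>i. axis i 1)"
  by (auto simp: cart_basis_def)

lemma orthonormal_cart_basis: "orthonormal (cart_basis :: (complex^'n) set)"
  unfolding orthonormal_def cart_basis_eq by (auto simp: cdot_axis) (auto simp: axis_def)

lemma trace_on_cart_basis: "trace_on (matrix_form A) cart_basis = trace A"
proof -
  have inj: "inj (\<lambda>i. axis i 1 :: complex^'n)" by (auto simp: inj_on_def axis_eq_axis)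
  have "matrix_form A (axis i 1) (axis i 1) = A $ i $ i" for i
  proof -
    have "(A *v axis i 1) $ i = (\<Sum>j\<in>UNIV. if j = i then A $ i $ j else 0)"
      unfolding matrix_vector_mult_def vec_lambda_beta by (intro sum.cong) (auto simp: axis_def)
    then show ?thesis by (simp add: matrix_form_def cdot_axis)
  qed
  then show ?thesis
    unfolding trace_on_def cart_basis_eq trace_def
    using sum.reindex[OF inj, of "\<lambda>v. matrix_form A v v"] by (simp add: o_def)
qed

text \<open>Translation back to matrices: \<open>B\<close> is \<open>b\<close> in the basis \<open>T\<close>, and the coordinates of \<open>B C - C B\<close> are
\<open>(b w - b v) g v w\<close>, where vanishing of the diagonal of \<open>A\<close> in the basis \<open>T\<close> settles \<open>v = w\<close>.\<close>

lemma commutator_from_diagonalization: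
  fixes A :: "complex^'n^'n"
  assumes T: "orthonormal T" "vec.span T = UNIV" and diag: "\<And>v. v \<in> T \<Longrightarrow> matrix_form A v v = 0"
    and b: "inj_on b T" "\<And>v. v \<in> T \<Longrightarrow> cmod (b v) \<le> 1"
    and M: "matrix_bounded T T (\<lambda>v w. matrix_form A v w / (b w - b v)) M" "M \<ge> 0"
  shows "\<exists>B C. A = commutator B C \<and> op_norm B \<le> 1 \<and> op_norm C \<le> M"
proof -
  interpret A: sesquilinear "matrix_form A" by (rule sesquilinear_matrix_form)
  define g where "g v w = matrix_form A v w / (b w - b v)" for v w
  have g: "(b w - b v) * g v w = matrix_form A v w" if "v \<in> T" "w \<in> T" for v w
    using diag b(1) that by (cases "v = w") (auto simp: g_def dest: inj_onD)
  define F where "F x = (\<Sum>v\<in>T. (b v * cdot x v) *s v)" for x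
  define G where "G x = (\<Sum>w\<in>T. (\<Sum>v\<in>T. cdot x v * g v w) *s w)" for x
  have "Vector_Spaces.linear (*s) (*s) F"
    by unfold_locales
      (auto simp: F_def cdot.expand algebra_simps vec.scale_left_distrib sum.distrib vec.scale_sum_right)
  then have F: "matrix F *v x = F x" for x by (rule matrix_works)
  have "Vector_Spaces.linear (*s) (*s) G"
    by unfold_locales
      (auto simp: G_def cdot.expand algebra_simps vec.scale_left_distrib sum.distrib vec.scale_sum_right sum_distrib_left)
  then have G: "matrix G *v x = G x" for x by (rule matrix_works)
  have coordF: "cdot (F x) w = b w * cdot x w" if "w \<in> T" for x w
    unfolding F_def by (rule cdot_sum_orthonormal[OF T(1) that])
  have coordG: "cdot (G x) w = (\<Sum>v\<in>T. cdot x v * g v w)" if "w \<in> T" for x w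
    unfolding G_def by (rule cdot_sum_orthonormal[OF T(1) that])
  have expansion: "x = (\<Sum>v\<in>T. cdot x v *s v)" for x
    using orthonormal_expansion[OF T(1)] T(2) by blast
  have l2: "norm x = l2norm T (cdot x)" for x
    using norm_eq_L2_coordinates[OF T(1)] T(2) by blast
  have "A *v x = F (G x) - G (F x)" for x
  proof -
    have "cdot (A *v x) w = cdot (F (G x) - G (F x)) w" if w: "w \<in> T" for w
    proof -
      have "cdot (A *v x) w = matrix_form A (\<Sum>v\<in>T. cdot x v *s v) w"
        unfolding matrix_form_def by (subst expansion[of x]) simp
      also have "\<dots> = (\<Sum>v\<in>T. cdot x v * ((b w - b v) * g v w))"
        unfolding A.sum_left A.scale_left by (intro sum.cong refl) (simp add: g w)
      also have "\<dots> = cdot (F (G x) - G (F x)) w"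
        by (simp add: cdot.diff_left coordF coordG w sum_distrib_left sum_subtractf[symmetric] algebra_simps)
      finally show ?thesis .
    qed
    then have "(\<Sum>w\<in>T. cdot (A *v x) w *s w) = (\<Sum>w\<in>T. cdot (F (G x) - G (F x)) w *s w)"
      by (intro sum.cong refl) simp
    then show ?thesis using expansion by metis
  qed
  then have "A = commutator (matrix F) (matrix G)"
    unfolding matrix_eq commutator_def
    by (simp add: matrix_vector_mult_diff_rdistrib F G flip: matrix_vector_mul_assoc)
  moreover have "op_norm (matrix F) \<le> 1"
    unfolding op_norm_def F
  proof (rule onorm_bound)
    fix x
    have "l2norm T (cdot (F x)) \<le> 1 * l2norm T (cdot x)"
      using b(2) by (intro l2norm_scale_le) (auto simp: coordF norm_mult mult_right_mono mult_left_le_one_le)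
    then show "norm (F x) \<le> 1 * norm x" unfolding l2 .
  qed simp
  moreover have "op_norm (matrix G) \<le> M"
    unfolding op_norm_def G
  proof (rule onorm_bound)
    fix x
    \<comment> \<open>The norm of \<open>G x\<close> is recovered by testing the form of \<open>G\<close> against \<open>G x\<close> itself.\<close>
    let ?y = "G x"
    have "cdot ?y ?y = (\<Sum>w\<in>T. (\<Sum>v\<in>T. cdot x v * g v w) * cnj (cdot ?y w))"
    proof -
      have "cdot ?y ?y = cdot (\<Sum>w\<in>T. cdot ?y w *s w) ?y"
        by (rule arg_cong[where f = "\<lambda>z. cdot z ?y", OF expansion])
      also have "\<dots> = (\<Sum>w\<in>T. cdot ?y w * cdot w ?y)"
        by (simp only: cdot.sum_left cdot.scale_left)
      also have "\<dots> = (\<Sum>w\<in>T. (\<Sum>v\<in>T. cdot x v * g v w) * cnj (cdot ?y w))"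
        by (intro sum.cong refl arg_cong2[where f = "(*)"] coordG cdot.hermitian)
      finally show ?thesis .
    qed
    also have "\<dots> = (\<Sum>v\<in>T. \<Sum>w\<in>T. cdot x v * cnj (cdot ?y w) * g v w)"
      by (subst sum.swap) (simp add: sum_distrib_left sum_distrib_right mult_ac)
    finally have "cmod (cdot ?y ?y) \<le> M * norm x * norm ?y"
      using M(1)[unfolded matrix_bounded_def, rule_format, of "cdot x" "cdot ?y"]
      by (simp only: g_def l2)
    then have "norm ?y * norm ?y \<le> M * norm x * norm ?y"
      by (simp add: cdot_self power2_eq_square norm_mult)
    then show "norm ?y \<le> M * norm x"
      using M(2) by (cases "norm ?y = 0") (auto simp: mult_le_cancel_right)
  qed (rule M(2))
  ultimately show ?thesis by blast
qed

text \<open>The depth of the recursion is \<open>q \<approx> ln n / (p ln 4)\<close>, and \<open>40\<^sup>q \<cdot> 8\<^sup>p\<close> is balanced by taking \<open>p\<close> of order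
\<open>x = \<surd>(ln n)\<close>, since then \<open>q\<close> is of order \<open>x\<close> too. The rough estimates \<open>40 \<le> 4\<^sup>3\<close> and \<open>8 \<le> e\<^sup>3\<close>
together with the rounding of \<open>p\<close> and \<open>q\<close> give \<open>320 exp (6 x)\<close>, and \<open>x \<ge> 1 / 4\<close> for \<open>n \<ge> 2\<close> absorbs the \<open>320\<close>.\<close>

lemma recursion_parameters:
  assumes "n \<ge> (1::nat)"
  shows "\<exists>p q. n \<le> (4^p)^q \<and> 40^q * 8^p \<le> 300 * exp (9 * sqrt (ln (real n)))"
proof (cases "n = 1")
  case True
  then show ?thesis by (intro exI[of _ 0]) simp
next
  case False
  with assms have n: "n \<ge> 2" by simp
  define x where "x = sqrt (ln (real n))"
  have l2: "ln (2::real) \<ge> 1/2" using exp_half_le2 by (subst ln_ge_iff) auto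
  have "ln (real n) \<ge> ln 2" using n by simp
  then have ln: "ln (real n) \<ge> (1/4)\<^sup>2" using l2 by (simp add: power2_eq_square)
  then have x: "x \<ge> 1/4" unfolding x_def by (rule real_le_rsqrt)
  have x2: "x\<^sup>2 = ln (real n)" using n by (simp add: x_def)
  define p where "p = nat \<lceil>x\<rceil>"
  define q where "q = nat \<lceil>x / ln 4\<rceil>"
  have p: "x \<le> p" "p \<le> x + 1" unfolding p_def using x by linarith+
  have l4: "ln (4::real) > 0" by simp
  have q: "x / ln 4 \<le> q" "q \<le> x / ln 4 + 1" unfolding q_def using x l4 by (auto simp: of_nat_nat)
  have "ln (real n) = x * x" using x2 by (simp add: power2_eq_square)
  also have "\<dots> \<le> p * (q * ln 4)"
    using p(1) q(1) x l4 by (intro mult_mono) (auto simp: divide_le_eq)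
  also have "\<dots> = ln ((4^p)^q)" by (simp add: ln_realpow)
  finally have "real n \<le> (4^p)^q" using n by (subst (asm) ln_le_cancel_iff) auto
  then have "real n \<le> real ((4^p)^q)" by simp
  then have "n \<le> (4^p)^q" by (simp only: of_nat_le_iff)
  moreover have "40^q * 8^p \<le> 300 * exp (9 * x)"
  proof -
    have e1: "(40::real)^q \<le> 40 * exp (3 * x)"
    proof -
      have "(40::real)^q = 40 powr q" by (simp add: powr_realpow)
      also have "\<dots> \<le> 40 powr (x / ln 4 + 1)" using q by (intro powr_mono) auto
      also have "\<dots> = 40 * 40 powr (x / ln 4)" by (simp add: powr_add)
      also have "(40::real) powr (x / ln 4) \<le> 64 powr (x / ln 4)"
        using x l4 by (intro powr_mono2) auto
      also have "(64::real) powr (x / ln 4) = exp (3 * x)"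
        using ln_realpow[of 4 3] l4 by (simp add: powr_def)
      finally show ?thesis by simp
    qed
    have e2: "(8::real)^p \<le> 8 * exp (3 * x)"
    proof -
      have "(8::real)^p = 8 powr p" by (simp add: powr_realpow)
      also have "\<dots> \<le> 8 powr (x + 1)" using p by (intro powr_mono) auto
      also have "\<dots> = 8 * 8 powr x" by (simp add: powr_add)
      also have "(8::real) powr x \<le> exp 3 powr x"
      proof -
        have "(2::real)^3 \<le> exp 1 ^ 3" using exp_ge_add_one_self[of 1] by (intro power_mono) auto
        then show ?thesis using x by (intro powr_mono2) (auto simp flip: exp_of_nat_mult)
      qed
      also have "exp 3 powr x = exp (3 * x)" by (simp add: powr_def mult.commute)
      finally show ?thesis by simp
    qed
    have "(40::real)^q * 8^p \<le> (40 * exp (3 * x)) * (8 * exp (3 * x))" by (intro mult_mono e1 e2) auto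
    also have "\<dots> = 320 * exp (6 * x)" by (simp flip: exp_add)
    also have "\<dots> \<le> (300 * exp (3 * x)) * exp (6 * x)"
    proof (intro mult_right_mono)
      show "320 \<le> 300 * exp (3 * x)" using exp_ge_add_one_self[of "3 * x"] x by linarith
    qed simp
    also have "\<dots> = 300 * exp (9 * x)" by (simp flip: exp_add)
    finally show ?thesis .
  qed
  ultimately show ?thesis unfolding x_def by blast
qed

theorem corollary2:
  fixes A :: "complex^'n^'n"
  assumes "trace A = 0"
  shows "\<exists>B C :: complex^'n^'n. A = commutator B C \<and>
    op_norm B * op_norm C \<le> 300 * exp (9 * sqrt (ln (real CARD('n)))) * op_norm A"
proof -
  interpret sesquilinear "matrix_form A" by (rule sesquilinear_matrix_form)
  let ?S = "cart_basis :: (complex^'n) set"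
  have card: "card ?S = CARD('n)"
    by (simp add: card_cart_basis)
  obtain p q where pq: "CARD('n) \<le> (4^p)^q" "40^q * 8^p \<le> 300 * exp (9 * sqrt (ln (real CARD('n))))"
    using recursion_parameters[of "CARD('n)"] by auto
  let ?M = "op_norm A * (40^q - 1) * 8^p"
  obtain T b where T: "orthonormal T" "vec.span T = vec.span ?S" "\<forall>v\<in>T. matrix_form A v v = 0" "inj_on b T"
    "\<forall>v\<in>T. cmod (b v) \<le> 1" "matrix_bounded T T (\<lambda>v w. matrix_form A v w / (b w - b v)) ?M"
    using commutator_solution[OF orthonormal_cart_basis _ bounded_on_matrix_form op_norm_nonneg, of p q]
      assms pq(1) card trace_on_cart_basis[of A] by auto
  have M: "?M \<ge> 0" using op_norm_nonneg[of A] by simp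
  have "vec.span T = UNIV" using T(2) vec.span_Basis by simp
  then obtain B C where BC: "A = commutator B C" "op_norm B \<le> 1" "op_norm C \<le> ?M"
    using commutator_from_diagonalization[OF T(1) _ _ T(4) _ T(6) M] T(3,5) by blast
  have "op_norm B * op_norm C \<le> 1 * ?M" using BC op_norm_nonneg by (intro mult_mono) auto
  also have "\<dots> \<le> op_norm A * (40^q * 8^p)"
    using op_norm_nonneg[of A] by (simp add: mult_left_mono mult.assoc)
  also have "\<dots> \<le> op_norm A * (300 * exp (9 * sqrt (ln (real CARD('n)))))"
    by (intro mult_left_mono pq(2) op_norm_nonneg)
  finally show ?thesis using BC(1) by (intro exI conjI) (auto simp: mult.commute)
qed

end
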